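(* Let $\Omega\in\mathcal{O}_C$ have thickness function $d:\partial C\to\mathbb{R}_+$ of class $C^2$ and return map $F:\partial C\to\partial C$, and let $c^*$ be a nondegenerate critical point of $d$. If the geometry of $\Omega$ and $C$ is sufficiently symmetric so that the operator $A(c^* )$ is known explicitly, then the Hessian $\mathrm{Hess}_{\partial C}(d)(c^* )$ is uniquely determined by $DF(c^* )$.
   Context: Convex core. $C\subset\mathbb{R}^N$ is a compact convex set with nonempty interior whose boundary $\partial C$ is a hypersurface of class $C^2$, with the induced Riemannian structure and outward unit normal $\nu(c)$ at $c\in\partial C$. $\nabla_{\partial C}$ and $\mathrm{Hess}_{\partial C}$ are the Riemannian gradient and Hessian (the latter as a self-adjoint operator on $T_c(\partial C)$). The shape operator $S_c$ is defined by $D\nu(c)[v]=-S_cv$. Class $\mathcal{O}_C$. An open set $\Omega\subset\mathbb{R}^N$ belongs to $\mathcal{O}_C$ if: (1) $\mathrm{int}(C)\subset\Omega$; (2) $\partial\Omega$ is Lipschitz outside $C$; (3) for every $c\in\partial C$ the ray $\{c+t\nu(c):t\ge 0\}$ intersects $\Omega$ in a connected set; (4) for almost every $x\in\partial\Omega$ at which the inward unit normal $n(x)$ exists, the half-line $\{x+tn(x):t\ge0\}$ intersects $C$. Thickness function: $d(c)=\sup\{r\ge0: c+r\nu(c)\in\Omega\}$. Radial map: $\Phi:\partial C\to\partial\Omega$, $\Phi(c)=c+d(c)\nu(c)$. Reciprocal map: $\pi:\partial\Omega\setminus C\to\partial C$, $\pi(x)=x+t(x)n(x)$, where $n(x)$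 is the inward unit normal to $\partial\Omega$ at $x$ and $t(x)$ is the smallest nonnegative number with $x+t(x)n(x)\in C$. Return map: $F=\pi\circ\Phi:\partial C\to\partial C$. Geometric operator. At a nondegenerate critical point $c^*$ of $d$ (gradient zero, Hessian invertible), the linearization of $F$ is written $DF(c^* )=I-A(c^* )\,\mathrm{Hess}_{\partial C}d(c^* )$, where $A(c^* )$ is the linear operator on $T_{c^*}(\partial C)$ given in the paper by $A(c^* )=2d(c^* )(I-d(c^* )S_{c^*})^{-1}$. "Uniquely determined by $DF(c^* )$" means: given the known operator $A(c^* )$, the linear map $DF(c^* )$ determines the Hessian. *)

theory Defs
  imports "HOL-Analysis.Analysis"
begin

definition hausdorff_premeasure :: "nat \<Rightarrow> real \<Rightarrow> 'a::euclidean_space set \<Rightarrow> ennreal" where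
  "hausdorff_premeasure s \<delta> E =
     (INF U \<in> {U :: nat \<Rightarrow> 'a set. E \<subseteq> (\<Union>i. U i) \<and> (\<forall>i. bounded (U i) \<and> diameter (U i) \<le> \<delta>)}.
        \<Sum>i. if U i = {} then 0 else ennreal (diameter (U i) ^ s))"

text \<open>Hausdorff measure up to a normalising constant, which is irrelevant here: it is only used
  to say that a set is null.\<close>

definition hausdorff_measure :: "nat \<Rightarrow> 'a::euclidean_space set \<Rightarrow> ennreal" where
  "hausdorff_measure s E = (SUP \<delta>\<in>{0<..}. hausdorff_premeasure s \<delta> E)"

text \<open>A unit vector \<open>n\<close> is the inward normal to the boundary of \<open>\<Omega>\<close> at \<open>x\<close> if, to first order
  at \<open>x\<close>, the set \<open>\<Omega>\<close> is the half-space \<open>{y. (y - x) \<bullet> n > 0}\<close>. Where the boundary is locally the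
  graph of a Lipschitz function, this says that the function is differentiable at the base point
  and that \<open>n\<close> is the classical normal to the graph. Such an \<open>n\<close> is unique.\<close>

definition is_inward_normal :: "'a::euclidean_space set \<Rightarrow> 'a \<Rightarrow> 'a \<Rightarrow> bool" where
  "is_inward_normal \<Omega> x n \<longleftrightarrow> norm n = 1 \<and>
     (\<forall>\<epsilon>>0. \<exists>\<delta>>0. \<forall>y\<in>ball x \<delta>.
        ((y - x) \<bullet> n > \<epsilon> * norm (y - x) \<longrightarrow> y \<in> \<Omega>) \<and>
        ((y - x) \<bullet> n < - \<epsilon> * norm (y - x) \<longrightarrow> y \<notin> \<Omega>))"

definition inward_normal :: "'a::euclidean_space set \<Rightarrow> 'a \<Rightarrow> 'a" where
  "inward_normal \<Omega> x = (THE n. is_inward_normal \<Omega> x n)"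

definition lipschitz_boundary_at :: "'a::euclidean_space set \<Rightarrow> 'a \<Rightarrow> bool" where
  "lipschitz_boundary_at \<Omega> x \<longleftrightarrow>
     (\<exists>e r L (f :: 'a \<Rightarrow> real). norm e = 1 \<and> r > 0 \<and> L-lipschitz_on {w. w \<bullet> e = 0} f \<and>
        (\<forall>y\<in>ball x r. y \<in> \<Omega> \<longleftrightarrow> f ((y - x) - ((y - x) \<bullet> e) *\<^sub>R e) < (y - x) \<bullet> e))"

definition C2_on :: "'a::euclidean_space set \<Rightarrow> ('a \<Rightarrow> real) \<Rightarrow> bool" where
  "C2_on U g \<longleftrightarrow>
     (\<exists>(G :: 'a \<Rightarrow> 'a) (H :: 'a \<Rightarrow> 'a \<Rightarrow>\<^sub>L 'a).
        (\<forall>x\<in>U. (g has_derivative (\<lambda>h. G x \<bullet> h)) (at x)) \<and>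
        (\<forall>x\<in>U. (G has_derivative blinfun_apply (H x)) (at x)) \<and>
        continuous_on U H)"

definition C2_hypersurface :: "'a::euclidean_space set \<Rightarrow> bool" where
  "C2_hypersurface M \<longleftrightarrow>
     (\<forall>c\<in>M. \<exists>U g. open U \<and> c \<in> U \<and> C2_on U g \<and>
        (\<forall>x\<in>U. \<not> (g has_derivative (\<lambda>h. 0)) (at x)) \<and> M \<inter> U = {x\<in>U. g x = 0})"

definition convex_core :: "'a::euclidean_space set \<Rightarrow> bool" where
  "convex_core C \<longleftrightarrow>
     compact C \<and> convex C \<and> interior C \<noteq> {} \<and> C2_hypersurface (frontier C)"

definition outward_normal :: "'a::euclidean_space set \<Rightarrow> 'a \<Rightarrow> 'a" where
  "outward_normal C c = - inward_normal (interior C) c"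


subsection \<open>Calculus on the boundary of the core\<close>

definition tangent_space :: "'a::euclidean_space set \<Rightarrow> 'a \<Rightarrow> 'a set" where
  "tangent_space C c = {v. v \<bullet> outward_normal C c = 0}"

definition tangent_proj :: "'a::euclidean_space set \<Rightarrow> 'a \<Rightarrow> 'a \<Rightarrow> 'a" where
  "tangent_proj C c v = v - (v \<bullet> outward_normal C c) *\<^sub>R outward_normal C c"

text \<open>The differential of a map along the hypersurface \<open>\<partial>C\<close>. A derivative within \<open>\<partial>C\<close> is determined
  only on the tangent space, so this is meaningful for tangent vectors only.\<close>

definition bdry_deriv :: "'a::euclidean_space set \<Rightarrow> ('a \<Rightarrow> 'b::real_normed_vector) \<Rightarrow> 'a \<Rightarrow> 'a \<Rightarrow> 'b" where
  "bdry_deriv C f c = frechet_derivative f (at c within frontier C)"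

definition C2_on_bdry :: "'a::euclidean_space set \<Rightarrow> ('a \<Rightarrow> real) \<Rightarrow> bool" where
  "C2_on_bdry C f \<longleftrightarrow>
     (\<forall>c\<in>frontier C. \<exists>U g. open U \<and> c \<in> U \<and> C2_on U g \<and> (\<forall>x\<in>U \<inter> frontier C. g x = f x))"

definition bdry_grad :: "'a::euclidean_space set \<Rightarrow> ('a \<Rightarrow> real) \<Rightarrow> 'a \<Rightarrow> 'a" where
  "bdry_grad C f c =
     (THE G. G \<in> tangent_space C c \<and> (\<forall>v\<in>tangent_space C c. G \<bullet> v = bdry_deriv C f c v))"

text \<open>The covariant derivative of the gradient: the Levi-Civita connection of the induced metric is
  the tangential part of the ambient derivative.\<close>

definition bdry_hess :: "'a::euclidean_space set \<Rightarrow> ('a \<Rightarrow> real) \<Rightarrow> 'a \<Rightarrow> 'a \<Rightarrow> 'a" where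
  "bdry_hess C f c v = tangent_proj C c (bdry_deriv C (bdry_grad C f) c v)"

definition nondegenerate_critical_point :: "'a::euclidean_space set \<Rightarrow> ('a \<Rightarrow> real) \<Rightarrow> 'a \<Rightarrow> bool" where
  "nondegenerate_critical_point C f c \<longleftrightarrow>
     c \<in> frontier C \<and> bdry_grad C f c = 0 \<and>
     bij_betw (bdry_hess C f c) (tangent_space C c) (tangent_space C c)"

definition shape_operator :: "'a::euclidean_space set \<Rightarrow> 'a \<Rightarrow> 'a \<Rightarrow> 'a" where
  "shape_operator C c v = - bdry_deriv C (outward_normal C) c v"


subsection \<open>The class of domains, thickness and return map\<close>

definition class_O :: "'a::euclidean_space set \<Rightarrow> 'a set set" where
  "class_O C = {\<Omega>. open \<Omega> \<and> interior C \<subseteq> \<Omega> \<and>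
     (\<forall>x\<in>frontier \<Omega> - C. lipschitz_boundary_at \<Omega> x) \<and>
     (\<forall>c\<in>frontier C. connected ({c + t *\<^sub>R outward_normal C c |t. t \<ge> 0} \<inter> \<Omega>)) \<and>
     hausdorff_measure (DIM('a) - 1)
       {x\<in>frontier \<Omega>. \<exists>n. is_inward_normal \<Omega> x n \<and> {x + t *\<^sub>R n |t. t \<ge> 0} \<inter> C = {}} = 0}"

definition thickness_set :: "'a::euclidean_space set \<Rightarrow> 'a set \<Rightarrow> 'a \<Rightarrow> real set" where
  "thickness_set C \<Omega> c = {r. r \<ge> 0 \<and> c + r *\<^sub>R outward_normal C c \<in> \<Omega>}"

text \<open>Inserting \<open>0\<close> makes the supremum, which is taken in the nonnegative reals, equal to \<open>0\<close> when
  the set is empty.\<close>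

definition thickness :: "'a::euclidean_space set \<Rightarrow> 'a set \<Rightarrow> 'a \<Rightarrow> real" where
  "thickness C \<Omega> c = Sup (insert 0 (thickness_set C \<Omega> c))"

text \<open>The thickness is a real-valued function (every supremum is finite) of class \<open>C\<^sup>2\<close>.\<close>

definition C2_thickness :: "'a::euclidean_space set \<Rightarrow> 'a set \<Rightarrow> bool" where
  "C2_thickness C \<Omega> \<longleftrightarrow>
     (\<forall>c\<in>frontier C. bdd_above (thickness_set C \<Omega> c)) \<and> C2_on_bdry C (thickness C \<Omega>)"

definition radial_map :: "'a::euclidean_space set \<Rightarrow> 'a set \<Rightarrow> 'a \<Rightarrow> 'a" where
  "radial_map C \<Omega> c = c + thickness C \<Omega> c *\<^sub>R outward_normal C c"

definition reciprocal_map :: "'a::euclidean_space set \<Rightarrow> 'a set \<Rightarrow> 'a \<Rightarrow> 'a" where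
  "reciprocal_map C \<Omega> x =
     x + Inf {t. t \<ge> 0 \<and> x + t *\<^sub>R inward_normal \<Omega> x \<in> C} *\<^sub>R inward_normal \<Omega> x"

definition return_map :: "'a::euclidean_space set \<Rightarrow> 'a set \<Rightarrow> 'a \<Rightarrow> 'a" where
  "return_map C \<Omega> = reciprocal_map C \<Omega> \<circ> radial_map C \<Omega>"

definition geometric_operator :: "'a::euclidean_space set \<Rightarrow> 'a set \<Rightarrow> 'a \<Rightarrow> 'a \<Rightarrow> 'a" where
  "geometric_operator C \<Omega> c v =
     (2 * thickness C \<Omega> c) *\<^sub>R
       inv_into (tangent_space C c) (\<lambda>w. w - thickness C \<Omega> c *\<^sub>R shape_operator C c w) v"

end

theory Submission imports Defs begin

text \<open>Along \<open>\<partial>C\<close> the boundary of \<open>\<Omega>\<close> is the normal graph of \<open>d\<close>. Its inward unit normal at \<open>\<Phi>(x)\<close>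
  is \<open>- (\<nu> - w) / |\<nu> - w|\<close>, where the tangent vector \<open>w\<close> solves \<open>w \<bullet> (I - d S) z = \<nabla>d \<bullet> z\<close> for all
  tangent \<open>z\<close>, with \<open>S\<close> the shape operator; convexity of \<open>C\<close> makes \<open>I - d S\<close> coercive, hence invertible. At a critical point \<open>w\<close>
  vanishes, so differentiating \<open>F(x) = \<Phi>(x) + t n\<close> and the equation for \<open>w\<close> gives
  \<open>(DF v - v) \<bullet> (I - d S) u = d (Hess d v \<bullet> u)\<close>. The operator \<open>A = 2 d (I - d S)\<^sup>-\<^sup>1\<close> determines the
  number \<open>d\<close> as soon as the tangent space is nontrivial, because \<open>2 A\<^sup>-\<^sup>1 = (1/d) I - S\<close> and \<open>S\<close> does
  not depend on \<open>\<Omega>\<close>; so \<open>DF\<close> and \<open>A\<close> determine the right-hand side.\<close>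

subsection \<open>Inward normals\<close>

text \<open>The boundary of \<open>C\<close> is only of class C2, so \<nu> is C1, the shape operator
  is merely continuous, and the nearest-point projection onto \<open>C\<close> is used only as a
  Lipschitz map. Nothing therefore makes the normal of \<open>\<Omega>\<close> along
  \<open>C\<close> differentiable at a general point. At a critical point it is: coercivity gives
  |w| \<le> |grad d|, so w vanishes to first order there, and a change of the shape operator that
  just tends to 0 contributes nothing to the derivative.

  Convexity takes the place of charts: every boundary point has a supporting half-space, every
  exterior point is c + t \<nu>(c) in exactly one way, and projecting a tangent line back onto
  \<open>C\<close> gives a curve in the boundary. Derivatives are taken within the closed set
  \<open>frontier C\<close>, which fixes them on tangent vectors only; this is why the final formula
  pairs tangent vectors.\<close>

lemma inward_normal_ray_in:
  assumes "is_inward_normal \<Omega> x n" "e \<bullet> n > 0"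
  shows "\<forall>\<^sub>F s in at_right 0. x + s *\<^sub>R e \<in> \<Omega>"
proof -
  have e: "norm e > 0" using assms(2) by auto
  \<comment> \<open>Half the cosine of the angle between \<open>e\<close> and \<open>n\<close>, so
    that the ray lies strictly inside the cone which the definition puts into
    \<open>\<Omega>\<close>.\<close>
  define \<epsilon> where "\<epsilon> = (e \<bullet> n) / (2 * norm e)"
  have "\<epsilon> > 0" using e assms(2) by (simp add: \<epsilon>_def)
  then obtain \<delta> where \<delta>: "\<delta> > 0"
      "\<And>y. y \<in> ball x \<delta> \<Longrightarrow> (y - x) \<bullet> n > \<epsilon> * norm (y - x) \<Longrightarrow> y \<in> \<Omega>"
    using assms(1) unfolding is_inward_normal_def by meson
  have "x + s *\<^sub>R e \<in> \<Omega>" if "0 < s" "s < \<delta> / norm e" for s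
  proof (rule \<delta>(2))
    show "x + s *\<^sub>R e \<in> ball x \<delta>" using that e by (simp add: dist_norm field_simps)
    show "(x + s *\<^sub>R e - x) \<bullet> n > \<epsilon> * norm (x + s *\<^sub>R e - x)"
      using that e assms(2) by (simp add: \<epsilon>_def field_simps)
  qed
  moreover have "\<delta> / norm e > 0" using \<delta>(1) e by simp
  ultimately show ?thesis unfolding eventually_at_right_field by blast
qed

lemma inward_normal_ray_out:
  assumes "is_inward_normal \<Omega> x n" "e \<bullet> n < 0"
  shows "\<forall>\<^sub>F s in at_right 0. x + s *\<^sub>R e \<notin> \<Omega>"
proof -
  \<comment> \<open>Passing to the complement exchanges the two cones of the definition.\<close>
  have "is_inward_normal (- \<Omega>) x (- n)"
    unfolding is_inward_normal_def
  proof (intro conjI allI impI)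
    show "norm (- n) = 1" using assms(1) by (simp add: is_inward_normal_def)
    fix \<epsilon> :: real assume "\<epsilon> > 0"
    then obtain \<delta> where \<delta>: "\<delta> > 0" "\<forall>y\<in>ball x \<delta>. ((y - x) \<bullet> n > \<epsilon> * norm (y - x) \<longrightarrow> y \<in> \<Omega>) \<and>
        ((y - x) \<bullet> n < - \<epsilon> * norm (y - x) \<longrightarrow> y \<notin> \<Omega>)"
      using assms(1) unfolding is_inward_normal_def by meson
    show "\<exists>\<delta>>0. \<forall>y\<in>ball x \<delta>. ((y - x) \<bullet> - n > \<epsilon> * norm (y - x) \<longrightarrow> y \<in> - \<Omega>) \<and>
        ((y - x) \<bullet> - n < - \<epsilon> * norm (y - x) \<longrightarrow> y \<notin> - \<Omega>)"
    proof (intro exI[of _ \<delta>] conjI ballI impI \<delta>(1))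
      fix y assume y: "y \<in> ball x \<delta>"
      show "y \<in> - \<Omega>" if "(y - x) \<bullet> - n > \<epsilon> * norm (y - x)"
        using \<delta>(2) y that by (auto simp: inner_minus_right)
      show "y \<notin> - \<Omega>" if "(y - x) \<bullet> - n < - \<epsilon> * norm (y - x)"
        using \<delta>(2) y that by (auto simp: inner_minus_right)
    qed
  qed
  from inward_normal_ray_in[OF this, of e] assms(2) show ?thesis by simp
qed

text \<open>For two distinct normals the direction n - m enters the set according to
  \<open>n\<close> and leaves it according to \<open>m\<close>: its products with them are 1 - n
  \<bullet> m > 0 and n \<bullet> m - 1 < 0.\<close>

lemma is_inward_normal_unique:
  assumes "is_inward_normal \<Omega> x n" "is_inward_normal \<Omega> x m"
  shows "n = m"
proof (rule ccontr)
  assume "n \<noteq> m"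
  have nm: "n \<bullet> n = 1" "m \<bullet> m = 1" using assms
    by (auto simp: is_inward_normal_def norm_eq_1)
  have "(n - m) \<bullet> (n - m) > 0" using \<open>n \<noteq> m\<close> by simp
  then have k: "n \<bullet> m < 1" using nm by (simp add: inner_diff inner_commute)
  have "\<forall>\<^sub>F s in at_right 0. x + s *\<^sub>R (n - m) \<in> \<Omega>"
    by (rule inward_normal_ray_in[OF assms(1)]) (use k nm in \<open>simp add: inner_diff inner_commute\<close>)
  moreover have "\<forall>\<^sub>F s in at_right 0. x + s *\<^sub>R (n - m) \<notin> \<Omega>"
    by (rule inward_normal_ray_out[OF assms(2)]) (use k nm in \<open>simp add: inner_diff inner_commute\<close>)
  ultimately have "\<forall>\<^sub>F s in at_right (0::real). False" by eventually_elim auto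
  then show False by simp
qed

lemma inward_normal_eqI: "is_inward_normal \<Omega> x n \<Longrightarrow> inward_normal \<Omega> x = n"
  unfolding inward_normal_def by (blast intro: the_equality is_inward_normal_unique)

text \<open>Differentiability at the one point \<open>x\<close> is enough. This matters for the
  distance to \<open>C\<close> minus the thickness at the nearest point, whose derivative is
  computed point by point.\<close>

lemma is_inward_normal_sublevel:
  assumes der: "(h has_derivative (\<lambda>k. m \<bullet> k)) (at x)" and "h x = 0" "m \<noteq> 0"
    and ev: "\<forall>\<^sub>F y in nhds x. y \<in> \<Omega> \<longleftrightarrow> h y < (0::real)"
  shows "is_inward_normal \<Omega> x (- sgn m)"
  unfolding is_inward_normal_def
proof (intro conjI allI impI)
  show "norm (- sgn m) = 1" using assms(3) by (simp add: norm_sgn)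
  fix \<epsilon> :: real assume "\<epsilon> > 0"
  define e where "e = \<epsilon> * norm m / 2"
  have e: "e > 0" using \<open>\<epsilon> > 0\<close> assms(3) by (simp add: e_def)
  then obtain \<delta>1 where \<delta>1: "\<delta>1 > 0"
      "\<And>y. norm (y - x) < \<delta>1 \<Longrightarrow> norm (h y - h x - m \<bullet> (y - x)) \<le> e * norm (y - x)"
    using der unfolding has_derivative_within_alt by blast
  obtain \<delta>2 where \<delta>2: "\<delta>2 > 0" "\<And>y. dist y x < \<delta>2 \<Longrightarrow> y \<in> \<Omega> \<longleftrightarrow> h y < 0"
    using ev unfolding eventually_nhds_metric by blast
  show "\<exists>\<delta>>0. \<forall>y\<in>ball x \<delta>.
        ((y - x) \<bullet> (- sgn m) > \<epsilon> * norm (y - x) \<longrightarrow> y \<in> \<Omega>) \<and>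
        ((y - x) \<bullet> (- sgn m) < - \<epsilon> * norm (y - x) \<longrightarrow> y \<notin> \<Omega>)"
  proof (intro exI[of _ "min \<delta>1 \<delta>2"] conjI ballI)
    show "0 < min \<delta>1 \<delta>2" using \<delta>1 \<delta>2 by simp
    fix y assume "y \<in> ball x (min \<delta>1 \<delta>2)"
    then have y: "norm (y - x) < \<delta>1" "dist y x < \<delta>2" by (auto simp: dist_norm norm_minus_commute)
    have h: "\<bar>h y - m \<bullet> (y - x)\<bar> \<le> e * norm (y - x)" using \<delta>1(2)[OF y(1)] assms(2) by simp
    have sg: "(y - x) \<bullet> (- sgn m) = - (m \<bullet> (y - x)) / norm m"
      by (simp add: sgn_div_norm inner_commute divide_inverse)
    have nm: "norm m > 0" using assms(3) by simp
    have "e * norm (y - x) \<le> \<epsilon> * norm (y - x) * norm m" 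
      using \<open>\<epsilon> > 0\<close> by (simp add: e_def)
    show "(y - x) \<bullet> (- sgn m) > \<epsilon> * norm (y - x) \<longrightarrow> y \<in> \<Omega>"
      unfolding \<delta>2(2)[OF y(2)] sg less_divide_eq using h nm \<open>e * norm (y - x) \<le> _\<close> by (auto simp: abs_le_iff)
    show "(y - x) \<bullet> (- sgn m) < - \<epsilon> * norm (y - x) \<longrightarrow> y \<notin> \<Omega>"
      unfolding \<delta>2(2)[OF y(2)] sg divide_less_eq using h nm \<open>e * norm (y - x) \<le> _\<close> by (auto simp: abs_le_iff)
  qed
qed

text \<open>A defining function does not reveal on which side of its zero set \<open>C\<close> lies.
  Each of the two cones about \<plusminus> \<open>\<gamma>\<close> is free of zeros of
  \<open>g\<close> near \<open>c\<close>, so by connectedness it is inside the interior or disjoint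
  from it. An interior point off the tangent plane selects the inner cone; the other one cannot be
  inside as well, for then \<open>c\<close> would be a midpoint of interior points.\<close>

lemma ex_inward_normal_convex:
  fixes C :: "'a::euclidean_space set"
  assumes C: "convex C" "closed C" "interior C \<noteq> {}" and c: "c \<in> frontier C"
    and U: "open U" "c \<in> U" and der: "(g has_derivative (\<lambda>h. \<gamma> \<bullet> h)) (at c)" "\<gamma> \<noteq> 0"
    and fr: "frontier C \<inter> U = {x\<in>U. g x = (0::real)}"
  shows "\<exists>\<sigma>. (\<sigma> = 1 \<or> \<sigma> = - 1) \<and> is_inward_normal (interior C) c (\<sigma> *\<^sub>R sgn \<gamma>)"
proof -
  define m where "m = sgn \<gamma>"
  have nm: "norm m = 1" using der(2) by (simp add: m_def norm_sgn)
  define cone where "cone \<sigma> \<epsilon> \<delta> = ball c \<delta> \<inter> {y. \<sigma> * ((y - c) \<bullet> m) > \<epsilon> * norm (y - c)}" for \<sigma> \<epsilon> \<delta> :: real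
  have conv: "convex (cone \<sigma> \<epsilon> \<delta>)" if "\<epsilon> > 0" for \<sigma> \<epsilon> \<delta>
  proof -
    have "convex {y. \<sigma> * ((y - c) \<bullet> m) > \<epsilon> * norm (y - c)}"
    proof (rule convexI, safe)
      fix y z and u v :: real
      assume y: "\<sigma> * ((y - c) \<bullet> m) > \<epsilon> * norm (y - c)" and z: "\<sigma> * ((z - c) \<bullet> m) > \<epsilon> * norm (z - c)"
        and uv: "0 \<le> u" "0 \<le> v" "u + v = 1"
      have eq: "u *\<^sub>R y + v *\<^sub>R z - c = u *\<^sub>R (y - c) + v *\<^sub>R (z - c)"
      proof -
        have "c = (u + v) *\<^sub>R c" using uv by simp
        then show ?thesis by (metis (no_types, lifting) add_diff_add scaleR_left_distrib scaleR_right_diff_distrib)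
      qed
      have "\<epsilon> * norm (u *\<^sub>R y + v *\<^sub>R z - c) \<le> \<epsilon> * (u * norm (y - c) + v * norm (z - c))"
        unfolding eq using norm_triangle_ineq[of "u *\<^sub>R (y - c)" "v *\<^sub>R (z - c)"] uv that by simp
      also have "\<dots> = u * (\<epsilon> * norm (y - c)) + v * (\<epsilon> * norm (z - c))" by (simp add: algebra_simps)
      also have "\<dots> < u * (\<sigma> * ((y - c) \<bullet> m)) + v * (\<sigma> * ((z - c) \<bullet> m))"
      proof (cases "u = 0")
        case True
        then show ?thesis using uv z by simp
      next
        case False
        then have "u > 0" using uv by simp
        then show ?thesis using y z uv
          by (intro add_less_le_mono mult_strict_left_mono mult_left_mono) auto
      qed
      also have "\<dots> = \<sigma> * ((u *\<^sub>R y + v *\<^sub>R z - c) \<bullet> m)"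
        unfolding eq by (simp add: algebra_simps inner_add_left)
      finally show "\<sigma> * ((u *\<^sub>R y + v *\<^sub>R z - c) \<bullet> m) > \<epsilon> * norm (u *\<^sub>R y + v *\<^sub>R z - c)" .
    qed
    then show ?thesis unfolding cone_def by (intro convex_Int) auto
  qed
  have gc: "g c = 0" using fr c U by blast
  have dich: "\<exists>\<delta>>0. \<forall>\<sigma>. (\<sigma> = 1 \<or> \<sigma> = -1) \<longrightarrow> cone \<sigma> \<epsilon> \<delta> \<subseteq> interior C \<or> cone \<sigma> \<epsilon> \<delta> \<inter> interior C = {}"
    if \<epsilon>: "\<epsilon> > 0" for \<epsilon>
  proof -
    have "\<epsilon> * norm \<gamma> / 2 > 0" using \<epsilon> der(2) by simp
    then obtain \<delta>1 where \<delta>1: "\<delta>1 > 0"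
      "\<And>y. norm (y - c) < \<delta>1 \<Longrightarrow> norm (g y - g c - \<gamma> \<bullet> (y - c)) \<le> \<epsilon> * norm \<gamma> / 2 * norm (y - c)"
      using der(1) unfolding has_derivative_within_alt by blast
    obtain \<delta>2 where \<delta>2: "\<delta>2 > 0" "ball c \<delta>2 \<subseteq> U" using U open_contains_ball by metis
    define \<delta> where "\<delta> = min \<delta>1 \<delta>2"
    have "cone \<sigma> \<epsilon> \<delta> \<subseteq> interior C \<or> cone \<sigma> \<epsilon> \<delta> \<inter> interior C = {}" if \<sigma>: "\<sigma> = 1 \<or> \<sigma> = -1" for \<sigma>
    proof -
      have nofr: "cone \<sigma> \<epsilon> \<delta> \<inter> frontier C = {}"
      proof (rule ccontr)
        assume "cone \<sigma> \<epsilon> \<delta> \<inter> frontier C \<noteq> {}"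
        then obtain y where y: "y \<in> cone \<sigma> \<epsilon> \<delta>" "y \<in> frontier C" by blast
        then have "y \<in> U" using \<delta>2 by (auto simp: cone_def \<delta>_def)
        with fr y have "g y = 0" by blast
        moreover have "norm (y - c) < \<delta>1" using y by (auto simp: cone_def \<delta>_def dist_norm norm_minus_commute)
        ultimately have 1: "\<bar>\<gamma> \<bullet> (y - c)\<bar> \<le> \<epsilon> * norm \<gamma> / 2 * norm (y - c)"
          using \<delta>1(2)[of y] gc by simp
        have 2: "\<sigma> * ((y - c) \<bullet> m) > \<epsilon> * norm (y - c)" using y by (simp add: cone_def)
        have "(y - c) \<bullet> m = \<gamma> \<bullet> (y - c) / norm \<gamma>"
          by (simp add: m_def sgn_div_norm inner_commute divide_inverse)
        then have "\<sigma> * (\<gamma> \<bullet> (y - c)) > \<epsilon> * norm (y - c) * norm \<gamma>"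
          using 2 der(2) by (simp add: less_divide_eq)
        moreover have "\<sigma> * (\<gamma> \<bullet> (y - c)) \<le> \<bar>\<gamma> \<bullet> (y - c)\<bar>" using \<sigma> by auto
        moreover have "\<epsilon> * norm \<gamma> / 2 * norm (y - c) \<le> \<epsilon> * norm (y - c) * norm \<gamma>" using \<epsilon> by simp
        ultimately show False using 1 by linarith
      qed
      have "connected (cone \<sigma> \<epsilon> \<delta>)" using conv[OF \<epsilon>] convex_connected by blast
      with nofr connected_Int_frontier[of "cone \<sigma> \<epsilon> \<delta>" C]
      have "cone \<sigma> \<epsilon> \<delta> \<inter> C = {} \<or> cone \<sigma> \<epsilon> \<delta> \<subseteq> C" by blast
      then show ?thesis using nofr interior_subset[of C] closure_subset[of C] by (auto simp: frontier_def)
    qed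
    then show ?thesis using \<delta>1 \<delta>2 by (intro exI[of _ \<delta>]) (auto simp: \<delta>_def)
  qed
  \<comment> \<open>An interior point lying in the tangent plane is pushed off it along
    \<open>m\<close>.\<close>
  obtain p where p: "p \<in> interior C" "(p - c) \<bullet> m \<noteq> 0"
  proof -
    obtain q where q: "q \<in> interior C" using C(3) by blast
    show ?thesis
    proof (cases "(q - c) \<bullet> m = 0")
      case True
      obtain r where r: "r > 0" "cball q r \<subseteq> interior C"
        using q open_interior open_contains_cball by metis
      have "q + r *\<^sub>R m \<in> interior C" using r nm by (intro subsetD[OF r(2)]) (simp add: dist_norm)
      moreover have "(q + r *\<^sub>R m - c) \<bullet> m = r"
        using True nm by (simp add: inner_add_left inner_diff_left norm_eq_1)
      ultimately show ?thesis using that r by (metis less_irrefl)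
    qed (use q that in blast)
  qed
  define \<sigma> where "\<sigma> = sgn ((p - c) \<bullet> m)"
  have \<sigma>: "\<sigma> = 1 \<or> \<sigma> = -1" using p by (auto simp: \<sigma>_def sgn_if)
  have \<sigma>p: "\<sigma> * ((p - c) \<bullet> m) = \<bar>(p - c) \<bullet> m\<bar>" by (simp add: \<sigma>_def sgn_if)
  have cC: "c \<in> closure C" "c \<notin> interior C" using c by (auto simp: frontier_def)
  have pc: "p - c \<noteq> 0" using p(2) by auto
  have "is_inward_normal (interior C) c (\<sigma> *\<^sub>R m)"
    unfolding is_inward_normal_def
  proof (intro conjI allI impI)
    show "norm (\<sigma> *\<^sub>R m) = 1" using \<sigma> nm by auto
    fix \<epsilon>0 :: real assume "\<epsilon>0 > 0"
    \<comment> \<open>The cone is widened until it contains the direction from \<open>c\<close> to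
      \<open>p\<close>; \<open>\<epsilon> < 1\<close> puts its axis into it as well.\<close>
    define \<epsilon> where "\<epsilon> = min \<epsilon>0 (\<bar>(p - c) \<bullet> m\<bar> / (2 * norm (p - c)))"
    have \<epsilon>: "\<epsilon> > 0" "\<epsilon> \<le> \<epsilon>0" using \<open>\<epsilon>0 > 0\<close> p pc by (auto simp: \<epsilon>_def)
    have "\<bar>(p - c) \<bullet> m\<bar> \<le> norm (p - c)" using Cauchy_Schwarz_ineq2[of "p - c" m] nm by simp
    then have "\<bar>(p - c) \<bullet> m\<bar> / (2 * norm (p - c)) < 1"
      using pc by (intro divide_less_eq_1_pos[THEN iffD2]) (simp, smt (verit) zero_less_norm_iff)
    then have \<epsilon>1: "\<epsilon> < 1" by (simp add: \<epsilon>_def)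
    obtain \<delta> where \<delta>: "\<delta> > 0"
      "\<And>\<sigma>. \<sigma> = 1 \<or> \<sigma> = -1 \<Longrightarrow> cone \<sigma> \<epsilon> \<delta> \<subseteq> interior C \<or> cone \<sigma> \<epsilon> \<delta> \<inter> interior C = {}"
      using dich[OF \<epsilon>(1)] by blast
    define s where "s = min 1 (\<delta> / (2 * norm (p - c)))"
    have s: "0 < s" "s \<le> 1" "s * norm (p - c) < \<delta>"
    proof -
      show "0 < s" "s \<le> 1" using pc \<delta>(1) by (auto simp: s_def)
      have "s * norm (p - c) \<le> \<delta> / (2 * norm (p - c)) * norm (p - c)"
        unfolding s_def by (intro mult_right_mono) auto
      also have "\<dots> < \<delta>" using pc \<delta>(1) by simp
      finally show "s * norm (p - c) < \<delta>" .
    qed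
    have "c - s *\<^sub>R (c - p) \<in> interior C"
      using mem_interior_closure_convex_shrink[OF C(1) p(1) cC(1) s(1,2)] .
    moreover have "c - s *\<^sub>R (c - p) \<in> cone \<sigma> \<epsilon> \<delta>"
    proof -
      have "\<epsilon> * norm (p - c) \<le> \<bar>(p - c) \<bullet> m\<bar> / (2 * norm (p - c)) * norm (p - c)"
        unfolding \<epsilon>_def by (intro mult_right_mono) auto
      also have "\<dots> < \<sigma> * ((p - c) \<bullet> m)" unfolding \<sigma>p using p(2) pc by simp
      finally have "s * (\<epsilon> * norm (p - c)) < s * (\<sigma> * ((p - c) \<bullet> m))" using s by simp
      moreover have eq: "c - s *\<^sub>R (c - p) - c = s *\<^sub>R (p - c)" by (simp add: algebra_simps)
      moreover have "dist c (c - s *\<^sub>R (c - p)) = s * norm (p - c)"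
        using s(1) by (simp add: dist_norm norm_minus_commute)
      ultimately show ?thesis using s unfolding cone_def Int_iff mem_Collect_eq mem_ball eq
        by (simp add: mult.left_commute)
    qed
    ultimately have in1: "cone \<sigma> \<epsilon> \<delta> \<subseteq> interior C" using \<delta>(2)[OF \<sigma>] by blast
    have out1: "cone (-\<sigma>) \<epsilon> \<delta> \<inter> interior C = {}"
    proof (rule ccontr)
      assume "cone (-\<sigma>) \<epsilon> \<delta> \<inter> interior C \<noteq> {}"
      then have in2: "cone (-\<sigma>) \<epsilon> \<delta> \<subseteq> interior C" using \<delta>(2)[of "-\<sigma>"] \<sigma> by auto
      define r where "r = \<delta> / 2"
      have r: "0 < r" "r < \<delta>" using \<delta>(1) by (auto simp: r_def)
      have mm: "m \<bullet> m = 1" using nm by (simp add: norm_eq_1)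
      have "c + (r * \<sigma>) *\<^sub>R m \<in> cone \<sigma> \<epsilon> \<delta>" "c + (- r * \<sigma>) *\<^sub>R m \<in> cone (-\<sigma>) \<epsilon> \<delta>"
        using r \<sigma> nm mm \<epsilon>1 by (auto simp: cone_def dist_norm)
      then have "c + (r * \<sigma>) *\<^sub>R m \<in> interior C" "c + (- r * \<sigma>) *\<^sub>R m \<in> interior C"
        using in1 in2 by auto
      then have "(1/2) *\<^sub>R (c + (r * \<sigma>) *\<^sub>R m) + (1/2) *\<^sub>R (c + (- r * \<sigma>) *\<^sub>R m) \<in> interior C"
        using convexD[OF convex_interior[OF C(1)]] by force
      moreover have "(1/2) *\<^sub>R (c + (r * \<sigma>) *\<^sub>R m) + (1/2) *\<^sub>R (c + (- r * \<sigma>) *\<^sub>R m) = c"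
        by (simp add: algebra_simps flip: scaleR_add_left)
      ultimately show False using cC by simp
    qed
    show "\<exists>\<delta>>0. \<forall>y\<in>ball c \<delta>.
        ((y - c) \<bullet> (\<sigma> *\<^sub>R m) > \<epsilon>0 * norm (y - c) \<longrightarrow> y \<in> interior C) \<and>
        ((y - c) \<bullet> (\<sigma> *\<^sub>R m) < - \<epsilon>0 * norm (y - c) \<longrightarrow> y \<notin> interior C)"
    proof (intro exI[of _ \<delta>] conjI ballI \<delta>(1))
      fix y assume y: "y \<in> ball c \<delta>"
      have le: "\<epsilon> * norm (y - c) \<le> \<epsilon>0 * norm (y - c)" using \<epsilon> by (intro mult_right_mono) auto
      show "(y - c) \<bullet> (\<sigma> *\<^sub>R m) > \<epsilon>0 * norm (y - c) \<longrightarrow> y \<in> interior C"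
        using in1 y le by (auto simp: cone_def)
      show "(y - c) \<bullet> (\<sigma> *\<^sub>R m) < - \<epsilon>0 * norm (y - c) \<longrightarrow> y \<notin> interior C"
        using out1 y le by (auto simp: cone_def)
    qed
  qed
  then show ?thesis using \<sigma> unfolding m_def by blast
qed

section \<open>Derivatives of normalized vectors and of squeezed functions\<close>

lemma has_derivative_sgn:
  fixes f :: "'b::real_normed_vector \<Rightarrow> 'a::real_inner"
  assumes f: "(f has_derivative f') (at x within s)" and nz: "f x \<noteq> 0"
  shows "((\<lambda>x. sgn (f x)) has_derivative
    (\<lambda>h. (f' h - (sgn (f x) \<bullet> f' h) *\<^sub>R sgn (f x)) /\<^sub>R norm (f x))) (at x within s)"
proof -
  have n: "((\<lambda>x. norm (f x)) has_derivative (\<lambda>h. f' h \<bullet> sgn (f x))) (at x within s)"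
    using has_derivative_compose[OF f has_derivative_norm[OF nz]] .
  have "((\<lambda>x. inverse (norm (f x)) *\<^sub>R f x) has_derivative
    (\<lambda>h. inverse (norm (f x)) *\<^sub>R f' h +
       (- (inverse (norm (f x)) * (f' h \<bullet> sgn (f x)) * inverse (norm (f x)))) *\<^sub>R f x)) (at x within s)"
    by (rule has_derivative_scaleR[OF Deriv.has_derivative_inverse[OF _ n] f]) (use nz in auto)
  moreover have "inverse (norm (f x)) *\<^sub>R f' h +
       (- (inverse (norm (f x)) * (f' h \<bullet> sgn (f x)) * inverse (norm (f x)))) *\<^sub>R f x
     = (f' h - (sgn (f x) \<bullet> f' h) *\<^sub>R sgn (f x)) /\<^sub>R norm (f x)" for h
    by (simp add: sgn_div_norm algebra_simps inner_commute)
  ultimately show ?thesis by (simp add: sgn_div_norm)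
qed

text \<open>Meant for the distance to \<open>C\<close>, which is caught between an affine function
  and a norm, so that the nearest-point projection itself is never differentiated.\<close>

lemma has_derivative_squeeze:
  fixes a b f :: "'a::real_normed_vector \<Rightarrow> real"
  assumes "(a has_derivative L) (at x within s)" "(b has_derivative L) (at x within s)"
    and "a x = f x" "b x = f x" "\<forall>\<^sub>F y in at x within s. a y \<le> f y \<and> f y \<le> b y"
  shows "(f has_derivative L) (at x within s)"
  unfolding has_derivative_within_alt2
proof (intro conjI allI impI)
  show "bounded_linear L" using assms(1) has_derivative_bounded_linear by blast
  fix e :: real assume "e > 0"
  then have "\<forall>\<^sub>F y in at x within s. norm (a y - a x - L (y - x)) \<le> e * norm (y - x)"
     "\<forall>\<^sub>F y in at x within s. norm (b y - b x - L (y - x)) \<le> e * norm (y - x)"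
    using assms(1,2) unfolding has_derivative_within_alt2 by auto
  with assms(5) show "\<forall>\<^sub>F y in at x within s. norm (f y - f x - L (y - x)) \<le> e * norm (y - x)"
    by eventually_elim (use assms(3,4) in auto)
qed

subsection \<open>Cores with boundary of class \<open>C\<^sup>2\<close>\<close>

locale convex_core_set =
  fixes C :: "'a::euclidean_space set"
  assumes core: "convex_core C"
begin

abbreviation "S \<equiv> frontier C"
abbreviation "\<nu> \<equiv> outward_normal C"
abbreviation "T \<equiv> tangent_space C"
abbreviation "P \<equiv> tangent_proj C"

lemma convex_C: "convex C" and closed_C: "closed C" and compact_C: "compact C"
  and interior_C: "interior C \<noteq> {}" and C_ne: "C \<noteq> {}"
  using core interior_subset by (auto simp: convex_core_def compact_imp_closed)

lemma S_subset: "S \<subseteq> C" using closed_C by (simp add: frontier_subset_closed)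

lemma C2_defining_function:
  assumes "c \<in> S"
  obtains U G and H :: "'a \<Rightarrow> 'a \<Rightarrow>\<^sub>L 'a" where "open U" "c \<in> U"
    "\<And>x. x \<in> U \<Longrightarrow> (G has_derivative blinfun_apply (H x)) (at x)"
    "continuous_on U H" "\<And>x. x \<in> U \<Longrightarrow> G x \<noteq> 0"
    "\<And>x. x \<in> U \<inter> S \<Longrightarrow> \<exists>\<sigma>. (\<sigma> = 1 \<or> \<sigma> = - 1) \<and> is_inward_normal (interior C) x (\<sigma> *\<^sub>R sgn (G x))"
proof -
  obtain U g where U: "open U" "c \<in> U" "C2_on U g"
      "\<forall>x\<in>U. \<not> (g has_derivative (\<lambda>h. 0)) (at x)" "S \<inter> U = {x\<in>U. g x = 0}"
    using core assms unfolding convex_core_def C2_hypersurface_def by blast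
  obtain G and H :: "'a \<Rightarrow> 'a \<Rightarrow>\<^sub>L 'a" where G: "\<forall>x\<in>U. (g has_derivative (\<lambda>h. G x \<bullet> h)) (at x)"
      "\<forall>x\<in>U. (G has_derivative blinfun_apply (H x)) (at x)" "continuous_on U H"
    using U(3) unfolding C2_on_def by blast
  have nz: "G x \<noteq> 0" if "x \<in> U" for x
  proof
    assume "G x = 0"
    with G(1) that have "(g has_derivative (\<lambda>h. 0)) (at x)" by fastforce
    then show False using U(4) that by blast
  qed
  show thesis
  proof (rule that[OF U(1,2) _ G(3) nz])
    fix x assume "x \<in> U \<inter> S"
    then show "\<exists>\<sigma>. (\<sigma> = 1 \<or> \<sigma> = - 1) \<and> is_inward_normal (interior C) x (\<sigma> *\<^sub>R sgn (G x))"
      by (intro ex_inward_normal_convex[OF convex_C closed_C interior_C _ U(1) _ _ nz U(5)])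
        (use G in auto)
  qed (use G(2) in auto)
qed

lemma inward_normal_core: 
  assumes "c \<in> S" shows "is_inward_normal (interior C) c (- \<nu> c)"
proof -
  obtain n where n: "is_inward_normal (interior C) c n"
    using C2_defining_function[OF assms] assms by (metis IntI)
  then show ?thesis using inward_normal_eqI[OF n] by (simp add: outward_normal_def)
qed

lemma norm_normal: "c \<in> S \<Longrightarrow> norm (\<nu> c) = 1"
  using inward_normal_core by (force simp: is_inward_normal_def)

lemma normal_self: "c \<in> S \<Longrightarrow> \<nu> c \<bullet> \<nu> c = 1"
  using norm_normal by (simp add: norm_eq_1)

text \<open>By convexity the segment from \<open>c\<close> to an interior point runs in the
  interior, whereas a direction with positive component along \<open>\<nu> c\<close> leaves the
  interior at once.\<close>

lemma support_interior:
  assumes c: "c \<in> S" and y: "y \<in> interior C"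
  shows "(y - c) \<bullet> \<nu> c \<le> 0"
proof (rule ccontr)
  assume "\<not> (y - c) \<bullet> \<nu> c \<le> 0"
  then have "\<forall>\<^sub>F s in at_right 0. c + s *\<^sub>R (y - c) \<notin> interior C"
    by (intro inward_normal_ray_out[OF inward_normal_core[OF c]]) simp
  moreover have "c + s *\<^sub>R (y - c) \<in> interior C" if "0 < s" "s \<le> 1" for s
    using mem_interior_closure_convex_shrink[OF convex_C y _ that, of c] c
    by (simp add: frontier_def algebra_simps)
  then have "\<forall>\<^sub>F s in at_right 0. c + s *\<^sub>R (y - c) \<in> interior C"
    unfolding eventually_at_right_field by (intro exI[of _ 1]) auto
  ultimately have "\<forall>\<^sub>F s in at_right (0::real). False" by eventually_elim auto
  then show False by simp
qed

lemma support_interior_strict: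
  assumes c: "c \<in> S" and y: "y \<in> interior C"
  shows "(y - c) \<bullet> \<nu> c < 0"
proof -
  obtain r where r: "r > 0" "cball y r \<subseteq> interior C"
    using y open_interior open_contains_cball by metis
  have "y + r *\<^sub>R \<nu> c \<in> interior C" using r norm_normal[OF c] by (intro subsetD[OF r(2)]) (simp add: dist_norm)
  from support_interior[OF c this] show ?thesis
    using r(1) normal_self[OF c] by (simp add: inner_add_left inner_diff_left)
qed

lemma support:
  assumes c: "c \<in> S" and y: "y \<in> C"
  shows "(y - c) \<bullet> \<nu> c \<le> 0"
proof -
  have "closed {y. \<nu> c \<bullet> y \<le> \<nu> c \<bullet> c}" by (rule closed_halfspace_le)
  moreover have "interior C \<subseteq> {y. \<nu> c \<bullet> y \<le> \<nu> c \<bullet> c}"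
    using support_interior[OF c] by (auto simp: inner_diff_left inner_commute[of "\<nu> c"])
  ultimately have "closure (interior C) \<subseteq> {y. \<nu> c \<bullet> y \<le> \<nu> c \<bullet> c}" by (simp add: closure_minimal)
  moreover have "y \<in> closure (interior C)"
    using y convex_closure_interior[OF convex_C interior_C] closure_subset by blast
  ultimately have "\<nu> c \<bullet> y \<le> \<nu> c \<bullet> c" by blast
  then show ?thesis by (simp add: inner_diff_left inner_commute[of "\<nu> c"])
qed

text \<open>Together with \<open>outside_decomposition\<close> this makes nearest point and distance
  the inverse of (c, t) \<mapsto> c + t \<nu>(c) on the exterior, for t of any size because
  \<open>C\<close> is convex.\<close>

lemma closest_point_ray:
  assumes c: "c \<in> S" and t: "t \<ge> 0"
  shows "closest_point C (c + t *\<^sub>R \<nu> c) = c"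
proof (rule closest_point_unique[OF convex_C closed_C, symmetric])
  show "c \<in> C" using c S_subset by blast
  show "\<forall>z\<in>C. dist (c + t *\<^sub>R \<nu> c) c \<le> dist (c + t *\<^sub>R \<nu> c) z"
  proof
    fix z assume "z \<in> C"
    have "t \<le> (c + t *\<^sub>R \<nu> c - z) \<bullet> \<nu> c"
      using support[OF c \<open>z \<in> C\<close>] normal_self[OF c] by (simp add: inner_add_left inner_diff_left)
    also have "\<dots> \<le> norm (c + t *\<^sub>R \<nu> c - z)"
      using Cauchy_Schwarz_ineq2[of "c + t *\<^sub>R \<nu> c - z" "\<nu> c"] norm_normal[OF c] by simp
    finally show "dist (c + t *\<^sub>R \<nu> c) c \<le> dist (c + t *\<^sub>R \<nu> c) z"
      using t norm_normal[OF c] by (simp add: dist_norm)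
  qed
qed

lemma closest_point_in_S:
  assumes "y \<notin> interior C" shows "closest_point C y \<in> S"
proof (cases "y \<in> C")
  case True
  then show ?thesis using assms closure_subset by (auto simp: closest_point_self frontier_def)
next
  case False
  have "closest_point C y \<in> C" by (rule closest_point_in_set[OF closed_C C_ne])
  moreover have "closest_point C y \<notin> interior C"
    using closest_point_in_rel_interior[OF closed_C C_ne, of y] False interior_subset
      rel_interior_nonempty_interior[OF interior_C] affine_hull_nonempty_interior[OF interior_C]
    by (metis UNIV_I subsetD)
  ultimately show ?thesis using closure_subset by (auto simp: frontier_def)
qed

text \<open>The direction \<open>u\<close> from the nearest point to \<open>y\<close> supports
  \<open>C\<close>. If it differed from the normal, a small step along \<open>u - \<nu> c\<close>
  would enter the interior and yet have positive component along \<open>u\<close>.\<close>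

lemma outside_decomposition:
  assumes y: "y \<notin> C" 
  shows "y = closest_point C y + norm (y - closest_point C y) *\<^sub>R \<nu> (closest_point C y)"
proof -
  define c where "c = closest_point C y"
  define u where "u = sgn (y - c)"
  have c: "c \<in> S" unfolding c_def using closest_point_in_S y interior_subset by blast
  have "y \<noteq> c" using c S_subset y by blast
  then have nu: "u \<bullet> u = 1" by (simp add: u_def norm_sgn flip: norm_eq_1)
  have sup: "u \<bullet> (z - c) \<le> 0" if "z \<in> C" for z
    using closest_point_dot[OF convex_C closed_C that, of y] unfolding c_def[symmetric]
    by (simp add: u_def sgn_div_norm mult_le_0_iff)
  have "u = \<nu> c"
  proof (rule ccontr)
    assume "u \<noteq> \<nu> c"
    then have "(u - \<nu> c) \<bullet> (u - \<nu> c) > 0" by simp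
    then have lt: "u \<bullet> \<nu> c < 1" using nu normal_self[OF c] by (simp add: inner_diff inner_commute)
    have "\<forall>\<^sub>F s in at_right 0. c + s *\<^sub>R (u - \<nu> c) \<in> interior C"
      by (rule inward_normal_ray_in[OF inward_normal_core[OF c]])
        (use lt normal_self[OF c] in \<open>simp add: inner_diff\<close>)
    moreover have "\<forall>\<^sub>F s in at_right (0::real). s > 0" by (simp add: eventually_at_right_less)
    ultimately have "\<forall>\<^sub>F s in at_right (0::real). False"
    proof eventually_elim
      case (elim s)
      then have "u \<bullet> (c + s *\<^sub>R (u - \<nu> c) - c) \<le> 0" using sup interior_subset by blast
      then have "s * (1 - u \<bullet> \<nu> c) \<le> 0" using nu by (simp add: inner_diff_right right_diff_distrib)
      then show False using elim lt by (simp add: mult_le_0_iff)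
    qed
    then show False by simp
  qed
  then show ?thesis unfolding c_def[symmetric] using \<open>y \<noteq> c\<close>
    by (simp add: u_def[symmetric] flip: \<open>u = \<nu> c\<close>) (simp add: u_def sgn_div_norm)
qed

text \<open>The normalized gradient \<open>sgn (G x)\<close> is normal only up to a sign that could
  a priori vary with the boundary point. Continuity of \<open>N'\<close> is phrased through vector
  fields \<open>f\<close> because \<open>N' x\<close> is later applied to a projection that varies
  with \<open>x\<close>.\<close>

lemma normal_extension:
  assumes c: "c \<in> S"
  obtains U N N' where "open U" "c \<in> U" 
    "\<And>x. x \<in> U \<Longrightarrow> (N has_derivative N' x) (at x)"
    "\<And>f A. continuous_on A f \<Longrightarrow> A \<subseteq> U \<Longrightarrow> continuous_on A (\<lambda>x. N' x (f x))"
    "\<And>x. x \<in> U \<inter> S \<Longrightarrow> \<nu> x = N x"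
proof -
  obtain U G and H :: "'a \<Rightarrow> 'a \<Rightarrow>\<^sub>L 'a" where U: "open U" "c \<in> U"
    "\<And>x. x \<in> U \<Longrightarrow> (G has_derivative blinfun_apply (H x)) (at x)"
    "continuous_on U H" "\<And>x. x \<in> U \<Longrightarrow> G x \<noteq> 0"
    "\<And>x. x \<in> U \<inter> S \<Longrightarrow> \<exists>\<sigma>. (\<sigma> = 1 \<or> \<sigma> = - 1) \<and> is_inward_normal (interior C) x (\<sigma> *\<^sub>R sgn (G x))"
    using C2_defining_function[OF c] by blast
  obtain p where p: "p \<in> interior C" using interior_C by blast
  \<comment> \<open>Its sign compares \<open>G x\<close> with the outward normal: the fixed interior
    point lies strictly behind every tangent hyperplane, so \<open>q\<close> has no zero on
    \<open>S\<close> near \<open>c\<close> and keeps its sign there.\<close>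
  define q where "q x = (p - x) \<bullet> G x" for x
  have contG: "continuous_on U G"
    using U(3) by (meson continuous_at_imp_continuous_on has_derivative_continuous)
  have "continuous_on U (\<lambda>x. q x * q c)"
    unfolding q_def by (intro continuous_intros contG)
  then have "open (U \<inter> (\<lambda>x. q x * q c) -` {0<..})"
    using continuous_open_preimage[OF _ U(1) open_greaterThan] by blast
  moreover
  define V where "V = U \<inter> (\<lambda>x. q x * q c) -` {0<..}"
  ultimately have V: "open V" "V \<subseteq> U" by auto
  have key: "q x \<noteq> 0 \<and> \<nu> x = - sgn (q x) *\<^sub>R sgn (G x)" if x: "x \<in> U \<inter> S" for x
  proof -
    obtain \<sigma> where \<sigma>: "\<sigma> = 1 \<or> \<sigma> = -1" "is_inward_normal (interior C) x (\<sigma> *\<^sub>R sgn (G x))"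
      using U(6)[OF x] by blast
    have eq: "\<nu> x = - (\<sigma> *\<^sub>R sgn (G x))"
      using inward_normal_eqI[OF \<sigma>(2)] by (simp add: outward_normal_def)
    have "(p - x) \<bullet> \<nu> x < 0" using support_interior_strict[of x p] x p by blast
    then have "\<sigma> * q x / norm (G x) > 0"
      by (simp add: eq q_def sgn_div_norm divide_inverse ac_simps)
    then have "\<sigma> * q x > 0" by (simp add: zero_less_divide_iff)
    then have "sgn (q x) = \<sigma>" "q x \<noteq> 0" using \<sigma>(1) by auto
    then show ?thesis using eq by simp
  qed
  have qc: "q c \<noteq> 0" using key c U(2) by blast
  then have cV: "c \<in> V" using U(2) by (auto simp: V_def zero_less_mult_iff)
  define \<sigma> where "\<sigma> = - sgn (q c)"
  define N where "N x = \<sigma> *\<^sub>R sgn (G x)" for x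
  define N' where "N' x h = \<sigma> *\<^sub>R ((H x h - (sgn (G x) \<bullet> H x h) *\<^sub>R sgn (G x)) /\<^sub>R norm (G x))" for x h
  show thesis
  proof (rule that[OF V(1) cV])
    show "(N has_derivative N' x) (at x)" if "x \<in> V" for x
      unfolding N_def N'_def using that V(2)
      by (intro has_derivative_scaleR_right has_derivative_sgn U(3,5)) auto
    show "continuous_on A (\<lambda>x. N' x (f x))" if "continuous_on A f" "A \<subseteq> V" for f A
    proof -
      have "A \<subseteq> U" using that V(2) by blast
      then show ?thesis unfolding N'_def
        by (intro continuous_intros that continuous_on_subset[OF contG] continuous_on_subset[OF U(4)])
          (use U(5) in auto)
    qed
    show "\<nu> x = N x" if "x \<in> V \<inter> S" for x
    proof -
      have "q x * q c > 0" "x \<in> U \<inter> S" using that by (auto simp: V_def)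
      then have "sgn (q x) = sgn (q c)" by (auto simp: zero_less_mult_iff sgn_if)
      then show ?thesis using key[OF \<open>x \<in> U \<inter> S\<close>] by (simp add: N_def \<sigma>_def)
    qed
  qed
qed

end

lemma has_derivative_agree_within:
  assumes "(F has_derivative F') (at x)" "open U" "x \<in> U" "x \<in> A" "\<And>y. y \<in> U \<inter> A \<Longrightarrow> F y = f y"
  shows "(f has_derivative F') (at x within A)"
proof (rule has_derivative_transform_eventually[OF has_derivative_at_withinI[OF assms(1)] _ _ assms(4)])
  show "\<forall>\<^sub>F y in at x within A. F y = f y"
    using assms by (auto simp: eventually_at_topological)
qed (use assms in auto)

context convex_core_set
begin

subsection \<open>Differentiation along the boundary of the core\<close>

lemma tangent_proj_in: "c \<in> S \<Longrightarrow> P c z \<in> T c"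
  by (simp add: tangent_proj_def tangent_space_def inner_diff_left normal_self)

lemma tangent_proj_self: "v \<in> T c \<Longrightarrow> P c v = v"
  by (simp add: tangent_proj_def tangent_space_def)

lemma inner_tangent_proj: "v \<in> T c \<Longrightarrow> P c z \<bullet> v = z \<bullet> v"
  by (simp add: tangent_proj_def tangent_space_def inner_diff_left inner_commute[of "\<nu> c"])

lemma ev_S: "\<forall>\<^sub>F y in at c within S. y \<in> S"
  by (simp add: eventually_at_filter)

lemma normal_differentiable:
  assumes "c \<in> S" shows "\<exists>D. (\<nu> has_derivative D) (at c within S)"
proof -
  obtain U N N' where "open U" "c \<in> U" 
    "\<And>x. x \<in> U \<Longrightarrow> (N has_derivative N' x) (at x)"
    "\<And>x. x \<in> U \<inter> S \<Longrightarrow> \<nu> x = N x"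
    using normal_extension[OF assms] by metis
  then show ?thesis using has_derivative_agree_within[of N "N' c" c U S \<nu>] assms by auto
qed

lemma normal_continuous: "continuous_on S \<nu>"
  using normal_differentiable has_derivative_continuous 
  by (force simp: continuous_on_eq_continuous_within)

text \<open>The supporting half-spaces at \<open>c\<close> and at \<open>y\<close> bound the depth
  of \<open>y\<close> below the tangent plane at \<open>c\<close> by
  \<open>(y - c) \<bullet> (\<nu> y - \<nu> c)\<close>, which is of smaller order since the normal
  is continuous.\<close>

lemma normal_component_derivative_0:
  assumes c: "c \<in> S"
  shows "((\<lambda>y. (y - c) \<bullet> \<nu> c) has_derivative (\<lambda>h. 0)) (at c within S)"
  unfolding has_derivative_within_alt2
proof (intro conjI allI impI)
  fix e :: real assume "e > 0"
  have "(\<nu> \<longlongrightarrow> \<nu> c) (at c within S)" using normal_continuous c by (auto simp: continuous_on)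
  then have "\<forall>\<^sub>F y in at c within S. dist (\<nu> y) (\<nu> c) < e" using \<open>e > 0\<close> by (simp add: tendstoD)
  with ev_S show "\<forall>\<^sub>F y in at c within S. norm ((y - c) \<bullet> \<nu> c - (c - c) \<bullet> \<nu> c - 0) \<le> e * norm (y - c)"
  proof eventually_elim
    case (elim y)
    have "(y - c) \<bullet> \<nu> c \<le> 0" using support[OF c, of y] elim S_subset by blast
    moreover have "(y - c) \<bullet> \<nu> y \<ge> 0" using support[of y c] elim c S_subset by (auto simp: inner_diff_left)
    ultimately have "\<bar>(y - c) \<bullet> \<nu> c\<bar> \<le> (y - c) \<bullet> (\<nu> y - \<nu> c)" by (simp add: inner_diff_right)
    also have "\<dots> \<le> norm (y - c) * norm (\<nu> y - \<nu> c)" by (rule norm_cauchy_schwarz)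
    also have "\<dots> \<le> norm (y - c) * e" using elim by (intro mult_left_mono) (auto simp: dist_norm)
    finally show ?case by (simp add: mult.commute)
  qed
qed simp

text \<open>Within \<open>S\<close> the height over the tangent plane has both 0 and
  \<open>h \<bullet> \<nu> c\<close> as derivative, so any derivative may be changed in the normal
  direction; here it is made to vanish there.\<close>

lemma has_derivative_tangent_proj:
  fixes f :: "'a \<Rightarrow> 'b::real_normed_vector"
  assumes c: "c \<in> S" and f: "(f has_derivative A) (at c within S)"
  shows "(f has_derivative (\<lambda>h. A (P c h))) (at c within S)"
proof -
  interpret A: bounded_linear A using f has_derivative_bounded_linear by blast
  have 1: "((\<lambda>y. ((y - c) \<bullet> \<nu> c) *\<^sub>R A (\<nu> c)) has_derivative (\<lambda>h. 0)) (at c within S)"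
    using has_derivative_scaleR_left[OF normal_component_derivative_0[OF c]] by simp
  have 2: "((\<lambda>y. ((y - c) \<bullet> \<nu> c) *\<^sub>R A (\<nu> c)) has_derivative (\<lambda>h. (h \<bullet> \<nu> c) *\<^sub>R A (\<nu> c))) (at c within S)"
    by (auto intro!: derivative_eq_intros)
  from has_derivative_add[OF has_derivative_diff[OF f 2] 1] show ?thesis
    by (simp add: tangent_proj_def A.diff A.scaleR)
qed

text \<open>A curve in the boundary with velocity \<open>v\<close>, obtained without a chart by
  projecting the tangent line onto \<open>C\<close>. Such curves give uniqueness of derivatives on
  tangent vectors and the sign of the curvature.\<close>

definition tcurve :: "'a \<Rightarrow> 'a \<Rightarrow> real \<Rightarrow> 'a" where
  "tcurve c v s = closest_point C (c + s *\<^sub>R v)"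

lemma tcurve_0: "c \<in> S \<Longrightarrow> tcurve c v 0 = c"
  using S_subset by (auto simp: tcurve_def closest_point_self)

lemma tcurve_in_S:
  assumes "c \<in> S" "v \<in> T c" shows "tcurve c v s \<in> S"
  unfolding tcurve_def
proof (rule closest_point_in_S, rule)
  assume "c + s *\<^sub>R v \<in> interior C"
  from support_interior_strict[OF assms(1) this] assms(2) show False by (simp add: tangent_space_def)
qed

text \<open>Lowering \<open>c + s *\<^sub>R v\<close> by \<open>e * \<bar>s\<bar>\<close> along the
  normal reaches a point \<open>z\<close> of \<open>C\<close> when \<open>s\<close> is small, so the
  nearest point is no farther than that.\<close>

lemma tcurve_derivative:
  assumes c: "c \<in> S" and v: "v \<in> T c"
  shows "(tcurve c v has_derivative (\<lambda>s. s *\<^sub>R v)) (at 0)"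
  unfolding has_derivative_within_alt
proof (intro conjI allI impI)
  show "bounded_linear (\<lambda>s. s *\<^sub>R v)" by (intro bounded_linear_intros)
  fix e :: real assume e: "e > 0"
  define k where "k = norm v + e"
  have k: "k > 0" using e by (simp add: k_def add_nonneg_pos)
  \<comment> \<open>\<open>z\<close> has distance at most |s| k from \<open>c\<close> and depth e
    |s|, twice the \<open>\<epsilon>\<close>-fraction of that distance bound.\<close>
  define \<epsilon> where "\<epsilon> = e / (2 * k)"
  have "\<epsilon> > 0" using e k by (simp add: \<epsilon>_def)
  then obtain \<delta> where \<delta>: "\<delta> > 0" "\<And>y. y \<in> ball c \<delta> \<Longrightarrow> (y - c) \<bullet> - \<nu> c > \<epsilon> * norm (y - c) \<Longrightarrow> y \<in> interior C"
    using inward_normal_core[OF c] unfolding is_inward_normal_def by meson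
  show "\<exists>d>0. \<forall>s\<in>UNIV. norm (s - 0) < d \<longrightarrow> norm (tcurve c v s - tcurve c v 0 - (s - 0) *\<^sub>R v) \<le> e * norm (s - 0)"
  proof (intro exI[of _ "\<delta> / k"] conjI ballI impI)
    show "\<delta> / k > 0" using \<delta>(1) k by simp
    fix s :: real assume s: "norm (s - 0) < \<delta> / k"
    show "norm (tcurve c v s - tcurve c v 0 - (s - 0) *\<^sub>R v) \<le> e * norm (s - 0)"
    proof (cases "s = 0")
      case False
      define z where "z = c + s *\<^sub>R v - (e * \<bar>s\<bar>) *\<^sub>R \<nu> c"
      have zc: "z - c = s *\<^sub>R v - (e * \<bar>s\<bar>) *\<^sub>R \<nu> c" by (simp add: z_def)
      have "norm (z - c) \<le> \<bar>s\<bar> * norm v + e * \<bar>s\<bar>" unfolding zc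
        using norm_triangle_ineq4[of "s *\<^sub>R v" "(e * \<bar>s\<bar>) *\<^sub>R \<nu> c"] norm_normal[OF c] e by simp
      then have n: "norm (z - c) \<le> \<bar>s\<bar> * k" by (simp add: k_def algebra_simps)
      have "\<bar>s\<bar> * k < \<delta>" using s k by (simp add: less_divide_eq)
      then have "z \<in> ball c \<delta>" using n by (simp add: dist_norm norm_minus_commute)
      moreover have "(z - c) \<bullet> - \<nu> c > \<epsilon> * norm (z - c)"
      proof -
        have "\<epsilon> * norm (z - c) \<le> \<epsilon> * (\<bar>s\<bar> * k)" using n \<open>\<epsilon> > 0\<close> by simp
        also have "\<dots> = e * \<bar>s\<bar> / 2" using k by (simp add: \<epsilon>_def)
        also have "\<dots> < e * \<bar>s\<bar>" using e False by simp
        also have "\<dots> = (z - c) \<bullet> - \<nu> c"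
          using v normal_self[OF c] unfolding zc by (simp add: inner_diff_left tangent_space_def)
        finally show ?thesis .
      qed
      ultimately have "z \<in> C" using \<delta>(2) interior_subset by blast
      then have "dist (c + s *\<^sub>R v) (tcurve c v s) \<le> dist (c + s *\<^sub>R v) z"
        unfolding tcurve_def by (rule closest_point_le[OF closed_C])
      also have "\<dots> = e * \<bar>s\<bar>" using e norm_normal[OF c] by (simp add: z_def dist_norm)
      finally show ?thesis using tcurve_0[OF c]
        by (simp add: dist_norm norm_minus_commute algebra_simps)
    qed simp
  qed
qed

lemma tcurve_compose:
  assumes c: "c \<in> S" and v: "v \<in> T c" and f: "(f has_derivative A) (at c within S)"
  shows "((\<lambda>s. f (tcurve c v s)) has_derivative (\<lambda>s. A (s *\<^sub>R v))) (at 0)"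
proof -
  have "range (tcurve c v) \<subseteq> S" using tcurve_in_S[OF c v] by blast
  then have "(f has_derivative A) (at (tcurve c v 0) within range (tcurve c v))"
    using f has_derivative_subset tcurve_0[OF c] by metis
  then show ?thesis using has_derivative_in_compose[OF tcurve_derivative[OF c v]] by blast
qed

lemma tangent_derivative_unique:
  assumes "c \<in> S" "v \<in> T c" "(f has_derivative A) (at c within S)" "(f has_derivative B) (at c within S)"
  shows "A v = B v"
  using has_derivative_unique[OF tcurve_compose[OF assms(1,2,3)] tcurve_compose[OF assms(1,2,4)]]
  by (metis scaleR_one)

lemma bdry_deriv_has_derivative:
  assumes "(f has_derivative A) (at c within S)"
  shows "(f has_derivative bdry_deriv C f c) (at c within S)"
  unfolding bdry_deriv_def by (rule frechet_derivative_works[THEN iffD1, OF differentiableI[OF assms]])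

text \<open>\<open>frechet_derivative\<close> selects one of many derivatives within
  \<open>S\<close>; curves in \<open>S\<close> show that they agree on tangent vectors.\<close>

lemma bdry_deriv_eq:
  assumes "c \<in> S" "v \<in> T c" "(f has_derivative A) (at c within S)"
  shows "bdry_deriv C f c v = A v"
  using tangent_derivative_unique[OF assms(1,2) bdry_deriv_has_derivative[OF assms(3)] assms(3)] .

text \<open>Extended by zero in the normal direction, the differential of the normal field depends
  continuously on the base point; on tangent vectors it is minus the shape operator.\<close>

definition weingarten :: "'a \<Rightarrow> 'a \<Rightarrow> 'a" where
  "weingarten c z = bdry_deriv C \<nu> c (P c z)"

lemma weingarten_derivative:
  assumes c: "c \<in> S" shows "(\<nu> has_derivative weingarten c) (at c within S)"
proof -
  obtain D where "(\<nu> has_derivative D) (at c within S)" using normal_differentiable[OF c] by blast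
  from has_derivative_tangent_proj[OF c bdry_deriv_has_derivative[OF this]]
  show ?thesis unfolding weingarten_def[abs_def] .
qed

lemma weingarten_linear: "c \<in> S \<Longrightarrow> bounded_linear (weingarten c)"
  using weingarten_derivative has_derivative_bounded_linear by blast

lemma weingarten_shape: "v \<in> T c \<Longrightarrow> shape_operator C c v = - weingarten c v"
  unfolding shape_operator_def weingarten_def by (simp only: tangent_proj_self)

lemma weingarten_proj: "c \<in> S \<Longrightarrow> weingarten c (P c z) = weingarten c z"
  unfolding weingarten_def by (simp only: tangent_proj_self tangent_proj_in)

text \<open>Locally this is \<open>N' x\<close> applied to the projected vector
  \<open>P x z\<close>, whose variation with \<open>x\<close> the continuity clause of
  \<open>normal_extension\<close> allows for.\<close>

lemma weingarten_continuous: "continuous_on S (\<lambda>x. weingarten x z)"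
  unfolding continuous_on_eq_continuous_within
proof
  fix c assume c: "c \<in> S"
  obtain U N N' where U: "open U" "c \<in> U" 
    "\<And>x. x \<in> U \<Longrightarrow> (N has_derivative N' x) (at x)"
    "\<And>f A. continuous_on A f \<Longrightarrow> A \<subseteq> U \<Longrightarrow> continuous_on A (\<lambda>x. N' x (f x))"
    "\<And>x. x \<in> U \<inter> S \<Longrightarrow> \<nu> x = N x"
    using normal_extension[OF c] by blast
  have eq: "N' x (P x z) = weingarten x z" if "x \<in> U \<inter> S" for x
  proof -
    have x: "x \<in> U" "x \<in> S" using that by auto
    have "(\<nu> has_derivative N' x) (at x within S)"
      using has_derivative_agree_within[OF U(3)[OF x(1)] U(1) x] U(5) by metis
    then show ?thesis
      unfolding weingarten_def using bdry_deriv_eq[OF x(2) tangent_proj_in[OF x(2)]] by metis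
  qed
  have "continuous_on (U \<inter> S) (\<lambda>x. N' x (P x z))"
    unfolding tangent_proj_def
    by (intro U(4) continuous_intros continuous_on_subset[OF normal_continuous]) auto
  then have "continuous_on (U \<inter> S) (\<lambda>x. weingarten x z)"
    by (rule continuous_on_eq) (rule eq)
  then have "continuous (at c within U \<inter> S) (\<lambda>x. weingarten x z)"
    using c U by (auto simp: continuous_on_eq_continuous_within)
  then show "continuous (at c within S) (\<lambda>x. weingarten x z)"
    using at_within_nhd[OF U(2,1), of "U \<inter> S" S] by (simp add: Int_ac)
qed

lemma weingarten_tangent:
  assumes c: "c \<in> S" shows "weingarten c z \<bullet> \<nu> c = 0"
proof -
  have d: "((\<lambda>x. \<nu> x \<bullet> \<nu> x) has_derivative (\<lambda>h. \<nu> c \<bullet> weingarten c h + weingarten c h \<bullet> \<nu> c)) (at c within S)"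
    by (intro has_derivative_inner weingarten_derivative c)
  have "((\<lambda>x. \<nu> x \<bullet> \<nu> x) has_derivative (\<lambda>h. 0)) (at c within S)"
    by (rule has_derivative_transform[OF c _ has_derivative_const[of 1]]) (use normal_self in auto)
  from tangent_derivative_unique[OF c tangent_proj_in[OF c] d this, of z]
  show ?thesis by (simp add: inner_commute weingarten_proj[OF c])
qed

text \<open>The normal of a convex body is monotone: adding the support inequalities at
  \<open>c\<close> and \<open>y\<close> gives
  \<open>(\<nu> y - \<nu> c) \<bullet> (y - c) \<ge> 0\<close>. Dividing by s^2 along
  \<open>tcurve\<close> passes this on to the derivative.\<close>

lemma weingarten_nonneg:
  assumes c: "c \<in> S" shows "weingarten c z \<bullet> z \<ge> 0"
proof -
  define v where "v = P c z"
  have v: "v \<in> T c" using tangent_proj_in[OF c] by (simp add: v_def)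
  have quot: "((\<lambda>s. (f s - f 0) /\<^sub>R s) \<longlongrightarrow> D) (at_right 0)"
    if "(f has_derivative (\<lambda>s. s *\<^sub>R D)) (at 0)" for f :: "real \<Rightarrow> 'a" and D
  proof -
    have "((\<lambda>s. (1 / norm (s - 0)) *\<^sub>R (f s - (f 0 + (s - 0) *\<^sub>R D))) \<longlongrightarrow> 0) (at_right 0)"
      using has_derivative_at_withinI[OF that, of "{0<..}"] unfolding has_derivative_within by blast
    moreover have "\<forall>\<^sub>F s in at_right 0. (1 / norm (s - 0)) *\<^sub>R (f s - (f 0 + (s - 0) *\<^sub>R D)) = (f s - f 0) /\<^sub>R s - D"
      using eventually_at_right_less[of "0::real"] by eventually_elim (simp add: algebra_simps divide_inverse)
    ultimately have "((\<lambda>s. (f s - f 0) /\<^sub>R s - D) \<longlongrightarrow> 0) (at_right 0)"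
      using tendsto_cong by fast
    then show ?thesis using LIM_zero_iff by blast
  qed
  have "(\<lambda>s. weingarten c (s *\<^sub>R v)) = (\<lambda>s. s *\<^sub>R weingarten c v)"
    using weingarten_linear[OF c] by (simp add: bounded_linear.linear linear_scale)
  then have 1: "((\<lambda>s. (\<nu> (tcurve c v s) - \<nu> c) /\<^sub>R s) \<longlongrightarrow> weingarten c v) (at_right 0)"
    using quot[of "\<lambda>s. \<nu> (tcurve c v s)" "weingarten c v"]
      tcurve_compose[OF c v weingarten_derivative[OF c]] tcurve_0[OF c] by simp
  have 2: "((\<lambda>s. (tcurve c v s - c) /\<^sub>R s) \<longlongrightarrow> v) (at_right 0)"
    using quot[OF tcurve_derivative[OF c v]] tcurve_0[OF c] by simp
  have "0 \<le> weingarten c v \<bullet> v"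
  proof (rule tendsto_lowerbound[OF tendsto_inner[OF 1 2]])
    have "((\<nu> (tcurve c v s) - \<nu> c) /\<^sub>R s) \<bullet> ((tcurve c v s - c) /\<^sub>R s) \<ge> 0" for s
    proof -
      define y where "y = tcurve c v s"
      have y: "y \<in> S" using tcurve_in_S[OF c v] by (simp add: y_def)
      have "(y - c) \<bullet> \<nu> c \<le> 0" "(c - y) \<bullet> \<nu> y \<le> 0"
        using support[OF c, of y] support[OF y, of c] y c S_subset by auto
      then have "(\<nu> y - \<nu> c) \<bullet> (y - c) \<ge> 0" by (simp add: inner_diff inner_commute)
      then have "inverse s * inverse s * ((\<nu> y - \<nu> c) \<bullet> (y - c)) \<ge> 0" by (metis mult_nonneg_nonneg zero_le_square)
      then show ?thesis by (simp add: y_def mult.assoc)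
    qed
    then show "\<forall>\<^sub>F s in at_right 0. 0 \<le> ((\<nu> (tcurve c v s) - \<nu> c) /\<^sub>R s) \<bullet> ((tcurve c v s - c) /\<^sub>R s)"
      by simp
  qed simp
  moreover have "weingarten c v \<bullet> v = weingarten c z \<bullet> z"
    using weingarten_tangent[OF c] unfolding v_def weingarten_proj[OF c]
    by (simp add: tangent_proj_def inner_diff_right)
  ultimately show ?thesis by simp
qed

end

text \<open>A product rule in which \<open>q\<close> only has to tend to 0, because \<open>p\<close>
  vanishes at \<open>x\<close> and is differentiable there. It lets quantities that are merely
  continuous, such as the shape operator, occur inside a function to be differentiated.\<close>

lemma has_derivative_product_0:
  fixes p :: "'a::real_normed_vector \<Rightarrow> 'b::real_normed_vector" and F :: "'a \<Rightarrow> 'c::real_normed_vector"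
    and q :: "'a \<Rightarrow> 'd::real_normed_vector"
  assumes p: "(p has_derivative p') (at x within A)" "p x = 0" and q: "(q \<longlongrightarrow> 0) (at x within A)"
    and F: "\<forall>\<^sub>F y in at x within A. norm (F y) \<le> norm (p y) * norm (q y)" "F x = 0"
  shows "(F has_derivative (\<lambda>h. 0)) (at x within A)"
  unfolding has_derivative_within_alt2
proof (intro conjI allI impI)
  fix e :: real assume e: "e > 0"
  obtain K where K: "K > 0" "\<And>h. norm (p' h) \<le> norm h * K"
    using bounded_linear.pos_bounded[OF has_derivative_bounded_linear[OF p(1)]] by blast
  have "\<forall>\<^sub>F y in at x within A. norm (p y - p x - p' (y - x)) \<le> 1 * norm (y - x)"
    using p(1) unfolding has_derivative_within_alt2 by (meson zero_less_one)
  moreover have "\<forall>\<^sub>F y in at x within A. dist (q y) 0 < e / (K + 1)"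
    using q e K by (intro tendstoD) auto
  ultimately show "\<forall>\<^sub>F y in at x within A. norm (F y - F x - 0) \<le> e * norm (y - x)"
    using F(1)
  proof eventually_elim
    case (elim y)
    have "norm (p y) \<le> norm (p y - p' (y - x)) + norm (p' (y - x))" by norm
    also have "\<dots> \<le> norm (y - x) * (K + 1)" using elim(1) K(2)[of "y - x"] p(2) by (simp add: algebra_simps)
    finally have "norm (p y) * norm (q y) \<le> norm (y - x) * (K + 1) * (e / (K + 1))"
      using elim(2) K(1) by (intro mult_mono) auto
    then show ?case using elim(3) F(2) K(1) by (simp add: mult.commute)
  qed
qed simp

section \<open>Coercive linear maps\<close>

lemma coercive_right_inverse:
  fixes M :: "'a::euclidean_space \<Rightarrow> 'a"
  assumes lin: "linear M" and co: "\<And>z. M z \<bullet> z \<ge> z \<bullet> z"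
  obtains R where "linear R" "\<And>z. M (R z) = z"
proof -
  have "inj M" unfolding linear_injective_0[OF lin]
    using co by (metis inner_eq_zero_iff inner_ge_zero inner_zero_left order_antisym)
  then have "surj M" using linear_injective_imp_surjective[OF lin] by simp
  then obtain R where "linear R" "M \<circ> R = id" using linear_surjective_right_inverse[OF lin] by blast
  then show thesis using that by (metis comp_apply id_apply)
qed

text \<open>The Lax-Milgram argument for the adjoint. Testing with \<open>w\<close> itself,
  coercivity with constant 1 gives the norm bound, through which the slope of the graph inherits the
  vanishing of the gradient.\<close>

lemma coercive_adjoint_solution:
  fixes M :: "'a::euclidean_space \<Rightarrow> 'a"
  assumes lin: "linear M" and co: "\<And>z. M z \<bullet> z \<ge> z \<bullet> z"
  obtains w where "\<And>z. w \<bullet> M z = G \<bullet> z" "norm w \<le> norm G"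
proof -
  have "adjoint M z \<bullet> z \<ge> z \<bullet> z" for z
    using co[of z] adjoint_works[OF lin, of z z] by (simp add: inner_commute)
  then obtain R where R: "\<And>z. adjoint M (R z) = z"
    using coercive_right_inverse[OF adjoint_linear[OF lin]] by metis
  have w: "R G \<bullet> M z = G \<bullet> z" for z
    using adjoint_works[OF lin, of z "R G"] R by (simp add: inner_commute)
  have "norm (R G) * norm (R G) \<le> R G \<bullet> M (R G)"
    using co[of "R G"] by (simp add: inner_commute power2_norm_eq_inner flip: power2_eq_square)
  also have "\<dots> \<le> norm G * norm (R G)" using w norm_cauchy_schwarz by metis
  finally have "norm (R G) \<le> norm G" by (cases "norm (R G) = 0") auto
  with w that show thesis by blast
qed

context convex_core_set
begin

section \<open>The Riemannian gradient along the boundary\<close>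

lemma bdry_grad_eq:
  assumes c: "c \<in> S" and f: "(f has_derivative (\<lambda>h. \<Gamma> \<bullet> h)) (at c within S)"
  shows "bdry_grad C f c = P c \<Gamma>"
  unfolding bdry_grad_def
proof (rule the_equality)
  show "P c \<Gamma> \<in> T c \<and> (\<forall>v\<in>T c. P c \<Gamma> \<bullet> v = bdry_deriv C f c v)"
    using tangent_proj_in[OF c] bdry_deriv_eq[OF c _ f] inner_tangent_proj by simp
  fix G assume G: "G \<in> T c \<and> (\<forall>v\<in>T c. G \<bullet> v = bdry_deriv C f c v)"
  have "G - P c \<Gamma> \<in> T c" using G tangent_proj_in[OF c, of \<Gamma>] by (simp add: tangent_space_def inner_diff_left)
  then have "(G - P c \<Gamma>) \<bullet> (G - P c \<Gamma>) = 0"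
    using G bdry_deriv_eq[OF c _ f] inner_tangent_proj by (simp add: inner_diff_left)
  then show "G = P c \<Gamma>" by simp
qed

lemma C2_on_bdry_extension:
  assumes f: "C2_on_bdry C f" and c: "c \<in> S"
  obtains U \<Gamma> D where "open U" "c \<in> U" "(\<Gamma> has_derivative D) (at c)"
    "\<And>x. x \<in> U \<inter> S \<Longrightarrow> (f has_derivative (\<lambda>h. \<Gamma> x \<bullet> h)) (at x within S)"
proof -
  obtain U g where U: "open U" "c \<in> U" "C2_on U g" "\<forall>x\<in>U \<inter> S. g x = f x"
    using f c unfolding C2_on_bdry_def by blast
  obtain \<Gamma> and H :: "'a \<Rightarrow> 'a \<Rightarrow>\<^sub>L 'a" where G: "\<forall>x\<in>U. (g has_derivative (\<lambda>h. \<Gamma> x \<bullet> h)) (at x)"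
      "\<forall>x\<in>U. (\<Gamma> has_derivative blinfun_apply (H x)) (at x)"
    using U(3) unfolding C2_on_def by blast
  show thesis
  proof (rule that[OF U(1,2)])
    show "(\<Gamma> has_derivative blinfun_apply (H c)) (at c)" using G(2) U(2) by blast
    fix x assume "x \<in> U \<inter> S"
    then have x: "x \<in> U" "x \<in> S" by auto
    then show "(f has_derivative (\<lambda>h. \<Gamma> x \<bullet> h)) (at x within S)"
      using has_derivative_agree_within[OF G(1)[rule_format, OF x(1)] U(1) x] U(4) by blast
  qed
qed

lemma bdry_grad_derivative:
  assumes f: "C2_on_bdry C f" and c: "c \<in> S"
  shows "(f has_derivative (\<lambda>h. bdry_grad C f c \<bullet> h)) (at c within S)" "bdry_grad C f c \<in> T c"
proof -
  obtain \<Gamma> where f': "(f has_derivative (\<lambda>h. \<Gamma> \<bullet> h)) (at c within S)"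
    using C2_on_bdry_extension[OF f c] c by (metis IntI)
  have "\<Gamma> \<bullet> P c h = P c \<Gamma> \<bullet> h" for h
    by (simp add: tangent_proj_def inner_diff inner_commute)
  then show "(f has_derivative (\<lambda>h. bdry_grad C f c \<bullet> h)) (at c within S)"
    using has_derivative_tangent_proj[OF c f'] bdry_grad_eq[OF c f'] by simp
  show "bdry_grad C f c \<in> T c" using bdry_grad_eq[OF c f'] tangent_proj_in[OF c] by simp
qed

lemma bdry_grad_differentiable:
  assumes f: "C2_on_bdry C f" and c: "c \<in> S"
  shows "(bdry_grad C f has_derivative bdry_deriv C (bdry_grad C f) c) (at c within S)"
proof -
  obtain U \<Gamma> D where U: "open U" "c \<in> U" "(\<Gamma> has_derivative D) (at c)"
    "\<And>x. x \<in> U \<inter> S \<Longrightarrow> (f has_derivative (\<lambda>h. \<Gamma> x \<bullet> h)) (at x within S)"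
    using C2_on_bdry_extension[OF f c] by blast
  have eq: "\<Gamma> x - (\<Gamma> x \<bullet> \<nu> x) *\<^sub>R \<nu> x = bdry_grad C f x" if "x \<in> U \<inter> S" for x
    using bdry_grad_eq[OF _ U(4)[OF that]] that by (simp add: tangent_proj_def)
  have "\<exists>D'. ((\<lambda>x. \<Gamma> x - (\<Gamma> x \<bullet> \<nu> x) *\<^sub>R \<nu> x) has_derivative D') (at c within S)"
    by (rule exI) (rule has_derivative_diff has_derivative_scaleR has_derivative_inner
      has_derivative_at_withinI[OF U(3)] weingarten_derivative[OF c])+
  then obtain D' where D': "((\<lambda>x. \<Gamma> x - (\<Gamma> x \<bullet> \<nu> x) *\<^sub>R \<nu> x) has_derivative D') (at c within S)" by blast
  have "(bdry_grad C f has_derivative D') (at c within S)"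
  proof (rule has_derivative_transform_eventually[OF D' _ _ c])
    show "\<forall>\<^sub>F x in at c within S. \<Gamma> x - (\<Gamma> x \<bullet> \<nu> x) *\<^sub>R \<nu> x = bdry_grad C f x"
      unfolding eventually_at_topological using U(1,2) eq by blast
  qed (use eq U(2) c in blast)
  then show ?thesis by (rule bdry_deriv_has_derivative)
qed

subsection \<open>The domain as a normal graph\<close>

text \<open>Openness of \<open>\<Omega>\<close> leaves room on the ray beyond \<open>t\<close>, so
  the supremum is not attained.\<close>

lemma less_thickness:
  assumes \<Omega>: "open \<Omega>" and b: "bdd_above (thickness_set C \<Omega> c)" and c: "c \<in> S"
    and t: "t \<in> thickness_set C \<Omega> c"
  shows "t < thickness C \<Omega> c"
proof -
  have t': "t \<ge> 0" "c + t *\<^sub>R \<nu> c \<in> \<Omega>" using t by (auto simp: thickness_set_def)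
  obtain r where r: "r > 0" "cball (c + t *\<^sub>R \<nu> c) r \<subseteq> \<Omega>" using \<Omega> t'(2) open_contains_cball by metis
  have "c + (t + r) *\<^sub>R \<nu> c \<in> cball (c + t *\<^sub>R \<nu> c) r"
    using r(1) norm_normal[OF c] by (simp add: dist_norm algebra_simps)
  then have "t + r \<in> thickness_set C \<Omega> c" using r t'(1) by (auto simp: thickness_set_def)
  then have "t + r \<le> thickness C \<Omega> c" unfolding thickness_def using b by (intro cSup_upper) auto
  then show ?thesis using r(1) by simp
qed

lemma thickness_interval:
  assumes con: "connected ({c + t *\<^sub>R \<nu> c |t. t \<ge> 0} \<inter> \<Omega>)" and c: "c \<in> S"
    and "r \<in> thickness_set C \<Omega> c" "s \<in> thickness_set C \<Omega> c" "r \<le> t" "t \<le> s"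
  shows "t \<in> thickness_set C \<Omega> c"
proof -
  have "(\<lambda>z. (z - c) \<bullet> \<nu> c) ` ({c + t *\<^sub>R \<nu> c |t. t \<ge> 0} \<inter> \<Omega>) = thickness_set C \<Omega> c"
  proof -
    have "{c + t *\<^sub>R \<nu> c |t. t \<ge> 0} \<inter> \<Omega> = (\<lambda>t. c + t *\<^sub>R \<nu> c) ` thickness_set C \<Omega> c"
      by (auto simp: thickness_set_def)
    then show ?thesis using normal_self[OF c] by (simp add: image_image)
  qed
  moreover have "connected ((\<lambda>z. (z - c) \<bullet> \<nu> c) ` ({c + t *\<^sub>R \<nu> c |t. t \<ge> 0} \<inter> \<Omega>))"
    by (intro connected_continuous_image con continuous_intros)
  ultimately have "is_interval (thickness_set C \<Omega> c)" by (simp add: is_interval_connected_1)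
  then show ?thesis using assms(3-6) unfolding is_interval_1 by blast
qed

lemma closest_point_continuous: "continuous_on A (closest_point C)"
  by (rule continuous_on_closest_point[OF convex_C closed_C C_ne])

text \<open>Connectedness of a ray only fills the gap between two known members. A member
  \<open>t0\<close> of the thickness set at \<open>c\<close> is therefore carried over to all nearby
  boundary points by openness of \<open>\<Omega>\<close> and serves as the lower end there.\<close>

lemma thickness_sublevel:
  assumes \<Omega>: "\<Omega> \<in> class_O C" and b: "\<forall>c\<in>S. bdd_above (thickness_set C \<Omega> c)"
    and c: "c \<in> S" and pos: "thickness C \<Omega> c > 0"
  shows "\<forall>\<^sub>F y in nhds (radial_map C \<Omega> c). y \<in> \<Omega> \<longleftrightarrow>
    norm (y - closest_point C y) - thickness C \<Omega> (closest_point C y) < 0"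
proof -
  define k where "k = closest_point C"
  define x where "x = radial_map C \<Omega> c"
  have op: "open \<Omega>" and con: "\<And>c. c \<in> S \<Longrightarrow> connected ({c + t *\<^sub>R \<nu> c |t. t \<ge> 0} \<inter> \<Omega>)"
    using \<Omega> by (auto simp: class_O_def)
  have kx: "k x = c" unfolding k_def x_def radial_map_def using closest_point_ray[OF c] pos by simp
  have "(x - c) \<bullet> \<nu> c > 0" using pos normal_self[OF c] by (simp add: x_def radial_map_def)
  then have xC: "x \<notin> C" using support[OF c] by force
  have kS: "k y \<in> S" if "y \<in> - C" for y using closest_point_in_S that interior_subset by (auto simp: k_def)
  obtain t0 where t0: "t0 \<in> thickness_set C \<Omega> c"
    using pos less_cSup_iff[of "insert 0 (thickness_set C \<Omega> c)" 0] b c by (auto simp: thickness_def)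
  have t0d: "t0 < thickness C \<Omega> c" using less_thickness[OF op b[rule_format, OF c] c t0] .
  \<comment> \<open>Both conditions are open, and \<open>x\<close> satisfies them because its
    distance from \<open>C\<close> is the thickness at \<open>c\<close>, which exceeds
    \<open>t0\<close>.\<close>
  define W where "W = (- C \<inter> (\<lambda>y. k y + t0 *\<^sub>R \<nu> (k y)) -` \<Omega>) \<inter> (- C \<inter> (\<lambda>y. norm (y - k y)) -` {t0<..})"
  have "continuous_on (- C) (\<lambda>y. \<nu> (k y))"
    by (rule continuous_on_compose2[OF normal_continuous]) (use kS closest_point_continuous in \<open>auto simp: k_def\<close>)
  moreover have "continuous_on (- C) k" unfolding k_def by (rule closest_point_continuous)
  ultimately have "open W" unfolding W_def
    by (intro open_Int continuous_open_preimage continuous_intros op open_greaterThan) (use closed_C in \<open>auto simp: open_Compl\<close>)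
  moreover have "x \<in> W"
    using xC t0 t0d norm_normal[OF c] by (auto simp: W_def kx thickness_set_def) (simp add: x_def radial_map_def)
  moreover have "y \<in> \<Omega> \<longleftrightarrow> norm (y - k y) - thickness C \<Omega> (k y) < 0" if y: "y \<in> W" for y
  proof -
    define t where "t = norm (y - k y)"
    have yC: "y \<notin> C" using y by (auto simp: W_def)
    have ky: "k y \<in> S" using kS yC by blast
    have eq: "k y + t *\<^sub>R \<nu> (k y) = y" using outside_decomposition[OF yC] unfolding t_def k_def by simp
    have t0': "t0 \<in> thickness_set C \<Omega> (k y)" "t0 \<le> t"
      using y t0 by (auto simp: W_def thickness_set_def t_def)
    have "y \<in> \<Omega> \<longleftrightarrow> t \<in> thickness_set C \<Omega> (k y)" by (simp add: thickness_set_def eq) (simp add: t_def)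
    also have "\<dots> \<longleftrightarrow> t < thickness C \<Omega> (k y)"
    proof
      assume "t < thickness C \<Omega> (k y)"
      then obtain r where "r \<in> insert 0 (thickness_set C \<Omega> (k y))" "t < r"
        using less_cSup_iff[of "insert 0 (thickness_set C \<Omega> (k y))" t] b ky by (auto simp: thickness_def)
      moreover have "t \<ge> 0" by (simp add: t_def)
      ultimately show "t \<in> thickness_set C \<Omega> (k y)"
        using thickness_interval[OF con[OF ky] ky t0'(1), of r t] t0'(2) by auto
    qed (rule less_thickness[OF op b[rule_format, OF ky] ky])
    finally show ?thesis by (simp add: t_def)
  qed
  ultimately show ?thesis unfolding eventually_nhds k_def x_def by blast
qed

text \<open>The nearest-point projection is 1-Lipschitz, so a remainder o(|z - c|) on the boundary
  becomes o(|y - x|) outside. This stands in for a chain rule.\<close>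

lemma closest_point_compose_0:
  assumes x: "x \<notin> C" and k: "closest_point C x = c"
    and f: "(f has_derivative (\<lambda>h. 0)) (at c within S)"
  shows "((\<lambda>y. f (closest_point C y)) has_derivative (\<lambda>h. 0)) (at x)"
  unfolding has_derivative_within_alt
proof (intro conjI allI impI)
  fix e :: real assume e: "e > 0"
  obtain \<delta> where \<delta>: "\<delta> > 0" "\<And>z. z \<in> S \<Longrightarrow> norm (z - c) < \<delta> \<Longrightarrow> norm (f z - f c - 0) \<le> e * norm (z - c)"
    using f e unfolding has_derivative_within_alt by blast
  obtain r where r: "r > 0" "ball x r \<subseteq> - C"
    using x closed_C by (metis ComplI open_Compl open_contains_ball)
  show "\<exists>d>0. \<forall>y\<in>UNIV. norm (y - x) < d \<longrightarrow> norm (f (closest_point C y) - f (closest_point C x) - 0) \<le> e * norm (y - x)"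
  proof (intro exI[of _ "min r \<delta>"] conjI ballI impI)
    show "0 < min r \<delta>" using r \<delta> by simp
    fix y assume y: "norm (y - x) < min r \<delta>"
    then have "y \<notin> C" using r(2) by (auto simp: dist_norm norm_minus_commute)
    then have "closest_point C y \<in> S" using closest_point_in_S interior_subset by blast
    moreover have le: "norm (closest_point C y - c) \<le> norm (y - x)"
      using closest_point_lipschitz[OF convex_C closed_C C_ne, of y x] k by (simp add: dist_norm)
    ultimately have "norm (f (closest_point C y) - f c - 0) \<le> e * norm (closest_point C y - c)"
      using \<delta>(2) y by simp
    also have "\<dots> \<le> e * norm (y - x)" using le e by simp
    finally show "norm (f (closest_point C y) - f (closest_point C x) - 0) \<le> e * norm (y - x)" using k by simp
  qed
qed simp

text \<open>The distance lies above the height over the supporting hyperplane at \<open>c\<close>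
  and below the distance to \<open>c\<close>; both touch it at the given point and have gradient
  \<open>\<nu> c\<close> there.\<close>

lemma distance_derivative:
  assumes c: "c \<in> S" and t: "t > 0"
  shows "((\<lambda>y. norm (y - closest_point C y)) has_derivative (\<lambda>h. \<nu> c \<bullet> h)) (at (c + t *\<^sub>R \<nu> c))"
proof (rule has_derivative_squeeze)
  define x where "x = c + t *\<^sub>R \<nu> c"
  have k: "closest_point C x = c" using closest_point_ray[OF c, of t] t by (simp add: x_def)
  have "(x - c) \<bullet> \<nu> c > 0" using t normal_self[OF c] by (simp add: x_def)
  then have xC: "x \<notin> C" using support[OF c] by force
  show "((\<lambda>y. (y - c) \<bullet> \<nu> c) has_derivative (\<lambda>h. \<nu> c \<bullet> h)) (at (c + t *\<^sub>R \<nu> c))"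
    by (auto intro!: derivative_eq_intros simp: inner_commute)
  have "x - c \<noteq> 0" using t norm_normal[OF c] by (auto simp: x_def)
  moreover have "sgn (x - c) = \<nu> c" using t norm_normal[OF c] by (simp add: x_def sgn_div_norm)
  ultimately show "((\<lambda>y. norm (y - c)) has_derivative (\<lambda>h. \<nu> c \<bullet> h)) (at (c + t *\<^sub>R \<nu> c))"
    using has_derivative_compose[OF has_derivative_diff[OF has_derivative_ident has_derivative_const[of c]] has_derivative_norm, of x UNIV]
    by (simp add: inner_commute x_def)
  show "(c + t *\<^sub>R \<nu> c - c) \<bullet> \<nu> c = norm (c + t *\<^sub>R \<nu> c - closest_point C (c + t *\<^sub>R \<nu> c))"
    "norm (c + t *\<^sub>R \<nu> c - c) = norm (c + t *\<^sub>R \<nu> c - closest_point C (c + t *\<^sub>R \<nu> c))"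
    using k t normal_self[OF c] norm_normal[OF c] by (auto simp: x_def)
  show "\<forall>\<^sub>F y in at (c + t *\<^sub>R \<nu> c). (y - c) \<bullet> \<nu> c \<le> norm (y - closest_point C y) \<and> norm (y - closest_point C y) \<le> norm (y - c)"
  proof (rule always_eventually, rule allI)
    fix y
    have kC: "closest_point C y \<in> C" by (rule closest_point_in_set[OF closed_C C_ne])
    have "(y - c) \<bullet> \<nu> c \<le> (y - closest_point C y) \<bullet> \<nu> c"
      using support[OF c kC] by (simp add: inner_diff_left)
    also have "\<dots> \<le> norm (y - closest_point C y)"
      using norm_cauchy_schwarz[of "y - closest_point C y" "\<nu> c"] norm_normal[OF c] by simp
    finally have 1: "(y - c) \<bullet> \<nu> c \<le> norm (y - closest_point C y)" .
    have "dist y (closest_point C y) \<le> dist y c" using closest_point_le[OF closed_C] c S_subset by blast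
    with 1 show "(y - c) \<bullet> \<nu> c \<le> norm (y - closest_point C y) \<and> norm (y - closest_point C y) \<le> norm (y - c)"
      by (simp add: dist_norm)
  qed
qed


text \<open>The identity minus \<open>t\<close> times the shape operator on the tangent space, extended by the identity in the normal direction.\<close>

definition tubeD :: "real \<Rightarrow> 'a \<Rightarrow> 'a \<Rightarrow> 'a" where
  "tubeD t c z = z + t *\<^sub>R weingarten c z"

lemma tubeD_linear: "c \<in> S \<Longrightarrow> linear (tubeD t c)"
  unfolding tubeD_def[abs_def]
  by (intro linear_compose_add linear_id[unfolded id_def] linear_compose_scale_right
    bounded_linear.linear weingarten_linear)

lemma tubeD_coercive: "c \<in> S \<Longrightarrow> t \<ge> 0 \<Longrightarrow> tubeD t c z \<bullet> z \<ge> z \<bullet> z"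
  using weingarten_nonneg[of c z] by (simp add: tubeD_def inner_add_left)

lemma tubeD_normal: "c \<in> S \<Longrightarrow> tubeD t c z \<bullet> \<nu> c = z \<bullet> \<nu> c"
  by (simp add: tubeD_def inner_add_left weingarten_tangent)

lemma weingarten_normal:
  assumes c: "c \<in> S" shows "weingarten c (\<nu> c) = 0"
proof -
  have "P c (\<nu> c) = 0" by (simp add: tangent_proj_def normal_self[OF c])
  then show ?thesis using weingarten_proj[OF c, of "\<nu> c"] weingarten_linear[OF c]
    by (simp add: bounded_linear.linear linear_0)
qed

text \<open>Write r for the distance and k for the nearest point, so y = k + r \<nu>(k). Pairing
  with \<open>w\<close> and replacing r by \<open>t\<close> and \<nu> by its linearization at
  \<open>c\<close> turns w \<bullet> y into \<open>w \<bullet> tubeD t c k\<close>, that is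
  \<open>G \<bullet> k\<close>, which is f(k) to first order. Hence f(k) has gradient
  \<open>w\<close>, although k is never differentiated.\<close>

lemma subgraph_derivative:
  assumes c: "c \<in> S" and t: "t > 0" and f: "(f has_derivative (\<lambda>h. G \<bullet> h)) (at c within S)"
    and w: "\<And>z. w \<bullet> tubeD t c z = G \<bullet> z" "w \<bullet> \<nu> c = 0"
  shows "((\<lambda>y. norm (y - closest_point C y) - f (closest_point C y)) has_derivative
    (\<lambda>h. (\<nu> c - w) \<bullet> h)) (at (c + t *\<^sub>R \<nu> c))"
proof -
  define k where "k = closest_point C"
  define x where "x = c + t *\<^sub>R \<nu> c"
  have kx: "k x = c" unfolding k_def x_def using closest_point_ray[OF c] t by simp
  have "(x - c) \<bullet> \<nu> c > 0" using t normal_self[OF c] by (simp add: x_def)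
  then have xC: "x \<notin> C" using support[OF c] by force
  have D: "((\<lambda>y. norm (y - k y)) has_derivative (\<lambda>h. \<nu> c \<bullet> h)) (at x)"
    unfolding k_def x_def by (rule distance_derivative[OF c t])
  have "((\<lambda>z. f z - G \<bullet> z) has_derivative (\<lambda>h. G \<bullet> h - G \<bullet> h)) (at c within S)"
    by (intro has_derivative_diff f has_derivative_inner_right has_derivative_ident)
  then have 1: "((\<lambda>y. f (k y) - G \<bullet> k y) has_derivative (\<lambda>h. 0)) (at x)"
    unfolding k_def using closest_point_compose_0[OF xC kx[unfolded k_def]] by simp
  have "((\<lambda>z. w \<bullet> \<nu> z - w \<bullet> weingarten c z) has_derivative (\<lambda>h. w \<bullet> weingarten c h - w \<bullet> weingarten c h)) (at c within S)"
    by (intro has_derivative_diff has_derivative_inner_right weingarten_derivative c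
      bounded_linear.has_derivative[OF weingarten_linear] has_derivative_ident)
  then have 2: "((\<lambda>y. w \<bullet> \<nu> (k y) - w \<bullet> weingarten c (k y)) has_derivative (\<lambda>h. 0)) (at x)"
    unfolding k_def using closest_point_compose_0[OF xC kx[unfolded k_def]] by simp
  have 3: "((\<lambda>y. (norm (y - k y) - t) * (w \<bullet> \<nu> (k y))) has_derivative (\<lambda>h. 0)) (at x)"
  proof (rule has_derivative_product_0[where q = "\<lambda>y. w \<bullet> \<nu> (k y)"])
    show "((\<lambda>y. norm (y - k y) - t) has_derivative (\<lambda>h. \<nu> c \<bullet> h - 0)) (at x)"
      by (intro has_derivative_diff D has_derivative_const)
    show "norm (x - k x) - t = 0" using norm_normal[OF c] t kx by (simp add: x_def)
    have "continuous_on (- C) (\<lambda>y. \<nu> (k y))"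
      unfolding k_def by (rule continuous_on_compose2[OF normal_continuous closest_point_continuous])
        (use closest_point_in_S interior_subset in auto)
    then have "isCont (\<lambda>y. \<nu> (k y)) x"
      using xC closed_C by (simp add: continuous_on_eq_continuous_at open_Compl)
    then have "((\<lambda>y. \<nu> (k y)) \<longlongrightarrow> \<nu> c) (at x)" using kx by (simp add: isCont_def)
    from tendsto_inner[OF tendsto_const[of w] this]
    show "((\<lambda>y. w \<bullet> \<nu> (k y)) \<longlongrightarrow> 0) (at x)" using w(2) by simp
    show "\<forall>\<^sub>F y in at x. norm ((norm (y - k y) - t) * (w \<bullet> \<nu> (k y))) \<le> norm (norm (y - k y) - t) * norm (w \<bullet> \<nu> (k y))"
      by (simp add: abs_mult)
    show "(norm (x - k x) - t) * (w \<bullet> \<nu> (k x)) = 0" using kx w(2) by simp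
  qed
  \<comment> \<open>Terms with derivative 0 plus \<open>w \<bullet> y\<close>; outside
    \<open>C\<close> the sum is exactly \<open>f (k y)\<close>.\<close>
  have "((\<lambda>y. (f (k y) - G \<bullet> k y) - t * (w \<bullet> \<nu> (k y) - w \<bullet> weingarten c (k y))
      - (norm (y - k y) - t) * (w \<bullet> \<nu> (k y)) + w \<bullet> y) has_derivative (\<lambda>h. 0 - t * 0 - 0 + w \<bullet> h)) (at x)"
    by (intro has_derivative_diff has_derivative_add 1 has_derivative_mult_right 2 3
        has_derivative_inner_right has_derivative_ident)
  then have "((\<lambda>y. f (k y)) has_derivative (\<lambda>h. 0 - t * 0 - 0 + w \<bullet> h)) (at x)"
  proof (rule has_derivative_transform_within_open)
    show "open (- C)" using closed_C by (simp add: open_Compl)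
    show "x \<in> - C" using xC by simp
    fix y assume "y \<in> - C"
    then have "y = k y + norm (y - k y) *\<^sub>R \<nu> (k y)"
      unfolding k_def using outside_decomposition by blast
    then have "w \<bullet> y = w \<bullet> k y + norm (y - k y) * (w \<bullet> \<nu> (k y))"
      by (metis inner_add_right inner_scaleR_right)
    moreover have "w \<bullet> k y + t * (w \<bullet> weingarten c (k y)) = G \<bullet> k y"
      using w(1)[of "k y"] by (simp add: tubeD_def inner_add_right)
    ultimately show "(f (k y) - G \<bullet> k y) - t * (w \<bullet> \<nu> (k y) - w \<bullet> weingarten c (k y))
      - (norm (y - k y) - t) * (w \<bullet> \<nu> (k y)) + w \<bullet> y = f (k y)" by (simp add: algebra_simps)
  qed
  from has_derivative_diff[OF D this] show ?thesis
    unfolding k_def x_def by (simp add: inner_diff_left)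
qed

text \<open>The slope field: the boundary of the domain is locally a normal graph over the core, and
  \<open>\<nu> - slope\<close> is an outward normal of this graph at the radial image.\<close>

definition slope :: "('a \<Rightarrow> real) \<Rightarrow> 'a \<Rightarrow> 'a" where
  "slope f c = (SOME w. (\<forall>z. w \<bullet> tubeD (f c) c z = bdry_grad C f c \<bullet> z) \<and> norm w \<le> norm (bdry_grad C f c))"

lemma slope:
  assumes c: "c \<in> S" and pos: "f c \<ge> 0"
  shows "slope f c \<bullet> tubeD (f c) c z = bdry_grad C f c \<bullet> z" "norm (slope f c) \<le> norm (bdry_grad C f c)"
proof -
  have "\<exists>w. (\<forall>z. w \<bullet> tubeD (f c) c z = bdry_grad C f c \<bullet> z) \<and> norm w \<le> norm (bdry_grad C f c)"
    using coercive_adjoint_solution[OF tubeD_linear[OF c] tubeD_coercive[OF c pos]] by metis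
  from someI_ex[OF this, folded slope_def]
  show "slope f c \<bullet> tubeD (f c) c z = bdry_grad C f c \<bullet> z" "norm (slope f c) \<le> norm (bdry_grad C f c)"
    by blast+
qed

lemma slope_normal:
  assumes f: "C2_on_bdry C f" and c: "c \<in> S" and pos: "f c \<ge> 0"
  shows "slope f c \<bullet> \<nu> c = 0"
proof -
  have "tubeD (f c) c (\<nu> c) = \<nu> c" by (simp add: tubeD_def weingarten_normal[OF c])
  then have "slope f c \<bullet> \<nu> c = bdry_grad C f c \<bullet> \<nu> c" using slope(1)[of c f "\<nu> c", OF c pos] by simp
  then show ?thesis using bdry_grad_derivative(2)[OF f c] by (simp add: tangent_space_def)
qed

lemma inward_normal_radial:
  assumes \<Omega>: "\<Omega> \<in> class_O C" "C2_thickness C \<Omega>" and c: "c \<in> S" and pos: "thickness C \<Omega> c > 0"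
  shows "inward_normal \<Omega> (radial_map C \<Omega> c) = - sgn (\<nu> c - slope (thickness C \<Omega>) c)"
proof -
  define d where "d = thickness C \<Omega>"
  have b: "\<forall>c\<in>S. bdd_above (thickness_set C \<Omega> c)" and C2: "C2_on_bdry C d"
    using \<Omega>(2) by (auto simp: C2_thickness_def d_def)
  have d: "d c > 0" using pos by (simp add: d_def)
  have sn: "slope d c \<bullet> \<nu> c = 0" using slope_normal[OF C2 c] d by simp
  have rad: "radial_map C \<Omega> c = c + d c *\<^sub>R \<nu> c" by (simp add: radial_map_def d_def)
  have k: "closest_point C (c + d c *\<^sub>R \<nu> c) = c" using closest_point_ray[OF c] d by simp
  have "is_inward_normal \<Omega> (radial_map C \<Omega> c) (- sgn (\<nu> c - slope d c))"
  proof (rule is_inward_normal_sublevel)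
    show "((\<lambda>y. norm (y - closest_point C y) - d (closest_point C y)) has_derivative
        (\<lambda>h. (\<nu> c - slope d c) \<bullet> h)) (at (radial_map C \<Omega> c))"
      unfolding rad by (rule subgraph_derivative[OF c d bdry_grad_derivative(1)[OF C2 c] slope(1)[OF c] sn])
        (use d in auto)
    show "norm (radial_map C \<Omega> c - closest_point C (radial_map C \<Omega> c)) - d (closest_point C (radial_map C \<Omega> c)) = 0"
      unfolding rad k using d norm_normal[OF c] by simp
    show "\<nu> c - slope d c \<noteq> 0"
    proof
      assume "\<nu> c - slope d c = 0"
      then show False using sn normal_self[OF c] by simp
    qed
    show "\<forall>\<^sub>F y in nhds (radial_map C \<Omega> c). (y \<in> \<Omega>) = (norm (y - closest_point C y) - d (closest_point C y) < 0)"
      using thickness_sublevel[OF \<Omega>(1) b c pos] by (simp add: d_def)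
  qed
  then show ?thesis unfolding d_def by (rule inward_normal_eqI)
qed

text \<open>The operator defining the slope depends on the base point only continuously. Freezing it
  at \<open>c\<close> costs the error \<open>slope f x \<bullet> q x\<close>, where \<open>q\<close>
  tends to 0 and the slope is bounded by the gradient, which vanishes at \<open>c\<close>; so the
  error has derivative 0.\<close>

lemma slope_derivative:
  assumes f: "C2_on_bdry C f" and c: "c \<in> S" and pos: "f c > 0" and crit: "bdry_grad C f c = 0"
  obtains W where "(slope f has_derivative W) (at c within S)"
    "\<And>h u. W h \<bullet> tubeD (f c) c u = bdry_deriv C (bdry_grad C f) c h \<bullet> u"
proof -
  define D where "D = bdry_deriv C (bdry_grad C f) c"
  have D: "(bdry_grad C f has_derivative D) (at c within S)"
    unfolding D_def by (rule bdry_grad_differentiable[OF f c])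
  have posc: "f c \<ge> 0" using pos by simp
  obtain R where R: "linear R" "\<And>z. tubeD (f c) c (R z) = z"
    using coercive_right_inverse[OF tubeD_linear[OF c] tubeD_coercive[OF c posc]] by metis
  have fc: "(f \<longlongrightarrow> f c) (at c within S)"
    using has_derivative_continuous[OF bdry_grad_derivative(1)[OF f c]] by (simp add: continuous_within)
  have evpos: "\<forall>\<^sub>F x in at c within S. f x > 0" using order_tendstoD(1)[OF fc pos] .
  have s0: "slope f c = 0" using slope(2)[of c f, OF c posc] crit by simp
  have comp: "((\<lambda>x. slope f x \<bullet> b) has_derivative (\<lambda>h. D h \<bullet> R b)) (at c within S)" for b
  proof -
    define q where "q x = tubeD (f c) c (R b) - tubeD (f x) x (R b)" for x
    have "((\<lambda>x. slope f x \<bullet> q x) has_derivative (\<lambda>h. 0)) (at c within S)"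
    proof (rule has_derivative_product_0[OF D crit, where q = q])
      have "((\<lambda>x. weingarten x (R b)) \<longlongrightarrow> weingarten c (R b)) (at c within S)"
        using weingarten_continuous c by (auto simp: continuous_on)
      then have "(q \<longlongrightarrow> tubeD (f c) c (R b) - tubeD (f c) c (R b)) (at c within S)"
        unfolding q_def tubeD_def by (intro tendsto_intros fc)
      then show "(q \<longlongrightarrow> 0) (at c within S)" by simp
      show "\<forall>\<^sub>F y in at c within S. norm (slope f y \<bullet> q y) \<le> norm (bdry_grad C f y) * norm (q y)"
        using evpos ev_S
      proof eventually_elim
        case (elim y)
        have "norm (slope f y \<bullet> q y) \<le> norm (slope f y) * norm (q y)" by (simp add: Cauchy_Schwarz_ineq2)
        also have "\<dots> \<le> norm (bdry_grad C f y) * norm (q y)"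
          using slope(2)[of y f] elim by (intro mult_right_mono) auto
        finally show ?case .
      qed
    qed (simp add: s0)
    from has_derivative_add[OF this has_derivative_inner_left[OF D, of "R b"]]
    have "((\<lambda>x. slope f x \<bullet> q x + bdry_grad C f x \<bullet> R b) has_derivative (\<lambda>h. D h \<bullet> R b)) (at c within S)" by simp
    then show ?thesis
    proof (rule has_derivative_transform_eventually)
      have eq: "slope f x \<bullet> q x + bdry_grad C f x \<bullet> R b = slope f x \<bullet> b" if "f x > 0" "x \<in> S" for x
        using slope(1)[of x f "R b"] that R(2) by (simp add: q_def inner_diff_right)
      show "\<forall>\<^sub>F x in at c within S. slope f x \<bullet> q x + bdry_grad C f x \<bullet> R b = slope f x \<bullet> b"
        using evpos ev_S by eventually_elim (rule eq)
      show "slope f c \<bullet> q c + bdry_grad C f c \<bullet> R b = slope f c \<bullet> b" using eq pos c by blast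
    qed (rule c)
  qed
  define W where "W h = (\<Sum>b\<in>Basis. (D h \<bullet> R b) *\<^sub>R b)" for h
  have Wb: "W h \<bullet> b = D h \<bullet> R b" if "b \<in> Basis" for h b
    using that by (simp add: W_def inner_sum_left inner_Basis if_distrib cong: if_cong)
  have "(slope f has_derivative W) (at c within S)"
    unfolding has_derivative_componentwise_within[of "slope f"] using comp Wb by simp
  moreover have "W h \<bullet> tubeD (f c) c u = D h \<bullet> u" for h u
  proof -
    have W: "W h \<bullet> y = D h \<bullet> R y" for y
    proof -
      have "W h \<bullet> y = (\<Sum>b\<in>Basis. (y \<bullet> b) * (D h \<bullet> R b))"
        using Wb by (subst euclidean_inner) (auto intro!: sum.cong simp: mult.commute)
      also have "\<dots> = D h \<bullet> R (\<Sum>b\<in>Basis. (y \<bullet> b) *\<^sub>R b)"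
        using R(1) by (simp add: linear_sum linear_scale inner_sum_right)
      finally show ?thesis by (simp add: euclidean_representation)
    qed
    \<comment> \<open>The right inverse is also a left inverse, since coercivity leaves no
      kernel.\<close>
    have "R (tubeD (f c) c u) = u"
    proof -
      define z where "z = R (tubeD (f c) c u) - u"
      have "tubeD (f c) c z = 0"
        unfolding z_def using R(2) tubeD_linear[OF c] by (simp add: linear_diff)
      then have "z \<bullet> z = 0" using tubeD_coercive[OF c posc, of z] inner_ge_zero[of z] by (simp del: inner_ge_zero)
      then show ?thesis by (simp add: z_def)
    qed
    then show ?thesis using W by simp
  qed
  ultimately show thesis using that unfolding D_def by blast
qed

end

lemma has_derivative_linear_bound:
  assumes "(f has_derivative f') (at x within A)"
  obtains L where "L > 0" "\<forall>\<^sub>F y in at x within A. norm (f y - f x) \<le> L * norm (y - x)"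
proof -
  obtain K where K: "K > 0" "\<And>h. norm (f' h) \<le> norm h * K"
    using bounded_linear.pos_bounded[OF has_derivative_bounded_linear[OF assms]] by blast
  have "\<forall>\<^sub>F y in at x within A. norm (f y - f x - f' (y - x)) \<le> 1 * norm (y - x)"
    using assms unfolding has_derivative_within_alt2 by (meson zero_less_one)
  then have "\<forall>\<^sub>F y in at x within A. norm (f y - f x) \<le> (K + 1) * norm (y - x)"
  proof eventually_elim
    case (elim y)
    have "norm (f y - f x) \<le> norm (f y - f x - f' (y - x)) + norm (f' (y - x))" by norm
    then show ?case using elim K(2)[of "y - x"] by (simp add: algebra_simps)
  qed
  then show thesis using that[of "K + 1"] K(1) by simp
qed

context convex_core_set
begin

subsection \<open>The return map\<close>

text \<open>Up to first order the ray meets the core where it meets the tangent hyperplane at \<open>c\<close>: it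
  cannot meet the core earlier, and slightly behind the hyperplane it is inside the core.\<close>

lemma hitting_time_derivative:
  assumes c: "c \<in> S" and \<Phi>: "(\<Phi> has_derivative \<Phi>') (at c within S)" "\<Phi> c = c + r *\<^sub>R \<nu> c" "r > 0"
    and n: "(n has_derivative n') (at c within S)" "n c = - \<nu> c"
    and n1: "\<forall>\<^sub>F x in at c within S. norm (n x) = 1"
  defines "\<tau> \<equiv> \<lambda>x. Inf {t. t \<ge> 0 \<and> \<Phi> x + t *\<^sub>R n x \<in> C}"
  shows "\<tau> c = r" "\<exists>\<tau>'. (\<tau> has_derivative \<tau>') (at c within S)"
proof -
  define A where "A x = (\<Phi> x - c) \<bullet> \<nu> c" for x
  define B where "B x = n x \<bullet> \<nu> c" for x
  \<comment> \<open>The time at which the ray crosses the tangent hyperplane at \<open>c\<close>: a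
    quotient of differentiable functions, in contrast to the infimum \<open>\<tau>\<close>.\<close>
  define \<tau>0 where "\<tau>0 x = - (A x / B x)" for x
  have Ac: "A c = r" and Bc: "B c = - 1" using \<Phi>(2) n(2) normal_self[OF c] by (auto simp: A_def B_def)
  have t0c: "\<tau>0 c = r" by (simp add: \<tau>0_def Ac Bc)
  have DA: "(A has_derivative (\<lambda>h. (\<Phi>' h - 0) \<bullet> \<nu> c)) (at c within S)"
    unfolding A_def by (intro has_derivative_inner_left has_derivative_diff \<Phi>(1) has_derivative_const)
  have DB: "(B has_derivative (\<lambda>h. n' h \<bullet> \<nu> c)) (at c within S)"
    unfolding B_def by (intro has_derivative_inner_left n(1))
  obtain \<tau>' where D0: "(\<tau>0 has_derivative \<tau>') (at c within S)"
    unfolding \<tau>0_def using has_derivative_minus[OF has_derivative_divide[OF DA DB]] Bc by auto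
  have "(B \<longlongrightarrow> - 1) (at c within S)" "(\<tau>0 \<longlongrightarrow> r) (at c within S)"
    using has_derivative_continuous[OF DB] has_derivative_continuous[OF D0] Bc t0c by (auto simp: continuous_within)
  then have evB: "\<forall>\<^sub>F x in at c within S. B x < - 1 / 2" and ev0: "\<forall>\<^sub>F x in at c within S. \<tau>0 x > 0"
    using order_tendstoD(2)[of B "-1" _ "-1/2"] order_tendstoD(1)[of \<tau>0 r _ 0] \<Phi>(3) by auto
  have lower: "\<tau>0 x \<le> t" if "B x < 0" "\<Phi> x + t *\<^sub>R n x \<in> C" for x t
  proof -
    have "(\<Phi> x + t *\<^sub>R n x - c) \<bullet> \<nu> c \<le> 0" by (rule support[OF c that(2)])
    then have "A x + t * B x \<le> 0" by (simp add: A_def B_def inner_add_left inner_diff_left)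
    then show ?thesis using that(1) by (simp add: \<tau>0_def field_simps)
  qed
  have squeeze: "\<tau>0 x \<le> \<tau> x \<and> \<tau> x \<le> t" if "B x < 0" "t \<ge> 0" "\<Phi> x + t *\<^sub>R n x \<in> C" for x t
    unfolding \<tau>_def
  proof
    show "\<tau>0 x \<le> Inf {t. 0 \<le> t \<and> \<Phi> x + t *\<^sub>R n x \<in> C}"
      using that lower[OF that(1)] by (intro cInf_greatest) auto
    show "Inf {t. 0 \<le> t \<and> \<Phi> x + t *\<^sub>R n x \<in> C} \<le> t"
      using that by (intro cInf_lower) (auto intro: bdd_belowI[of _ 0])
  qed
  have "\<Phi> c + r *\<^sub>R n c = c" using \<Phi>(2) n(2) by simp
  then show tc: "\<tau> c = r" using squeeze[of c r] Bc t0c \<Phi>(3) c S_subset by auto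
  define p where "p x = \<Phi> x + \<tau>0 x *\<^sub>R n x" for x
  have pc: "p c = c" using \<open>\<Phi> c + r *\<^sub>R n c = c\<close> by (simp add: p_def t0c)
  have "(p has_derivative (\<lambda>h. \<Phi>' h + (\<tau>0 c *\<^sub>R n' h + \<tau>' h *\<^sub>R n c))) (at c within S)"
    unfolding p_def by (intro has_derivative_add \<Phi>(1) has_derivative_scaleR D0 n(1))
  from has_derivative_linear_bound[OF this]
  obtain L where L: "L > 0" "\<forall>\<^sub>F x in at c within S. norm (p x - c) \<le> L * norm (x - c)"
    unfolding pc by blast
  have "((\<lambda>x. \<tau> x - \<tau>0 x) has_derivative (\<lambda>h. 0)) (at c within S)"
    unfolding has_derivative_within_alt2
  proof (intro conjI allI impI)
    fix e :: real assume e: "e > 0"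
    \<comment> \<open>Chosen so that \<open>\<epsilon> * norm (q - c)\<close> is at most e s / 4 for
      the point \<open>q\<close> below, whose depth behind the hyperplane exceeds e s / 2.\<close>
    define \<epsilon> where "\<epsilon> = e / (4 * (L + e))"
    have \<epsilon>: "\<epsilon> > 0" using e L by (simp add: \<epsilon>_def)
    then obtain \<delta> where \<delta>: "\<delta> > 0" "\<And>y. y \<in> ball c \<delta> \<Longrightarrow> (y - c) \<bullet> - \<nu> c > \<epsilon> * norm (y - c) \<Longrightarrow> y \<in> interior C"
      using inward_normal_core[OF c] unfolding is_inward_normal_def by meson
    have evd: "\<forall>\<^sub>F x in at c within S. x \<noteq> c \<and> dist x c < \<delta> / (L + e)"
      using \<delta>(1) e L(1) by (auto simp: eventually_at intro!: exI[of _ "\<delta> / (L + e)"])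
    show "\<forall>\<^sub>F x in at c within S. norm (\<tau> x - \<tau>0 x - (\<tau> c - \<tau>0 c) - 0) \<le> e * norm (x - c)"
      using evd L(2) evB ev0 n1
    proof eventually_elim
      case (elim x)
      define s where "s = norm (x - c)"
      have s: "s > 0" "s * (L + e) < \<delta>" using elim(1) e L(1) by (auto simp: s_def dist_norm less_divide_eq)
      \<comment> \<open>The point reached by following the ray for the extra time
        \<open>e * s\<close> beyond the hyperplane.\<close>
      define q where "q = p x + (e * s) *\<^sub>R n x"
      have pn: "(p x - c) \<bullet> \<nu> c = 0"
      proof -
        have "(p x - c) \<bullet> \<nu> c = A x + \<tau>0 x * B x"
          by (simp add: p_def A_def B_def inner_add_left inner_diff_left)
        then show ?thesis using elim(3) by (simp add: \<tau>0_def)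
      qed
      have "q - c = (p x - c) + (e * s) *\<^sub>R n x" by (simp add: q_def)
      then have "norm (q - c) \<le> norm (p x - c) + norm ((e * s) *\<^sub>R n x)" using norm_triangle_ineq by metis
      also have "\<dots> \<le> L * s + e * s" using elim(2,5) e s(1) by (simp add: s_def)
      finally have nq: "norm (q - c) \<le> s * (L + e)" by (simp add: algebra_simps)
      have "q \<in> interior C"
      proof (rule \<delta>(2))
        show "q \<in> ball c \<delta>" using nq s(2) by (simp add: dist_norm norm_minus_commute)
        have "\<epsilon> * norm (q - c) \<le> \<epsilon> * (s * (L + e))" using nq \<epsilon> by simp
        also have "\<dots> = \<epsilon> * (L + e) * s" by simp
        also have "\<epsilon> * (L + e) = e / 4" using e L(1) unfolding \<epsilon>_def by (simp add: divide_simps)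
        also have "e / 4 * s < e * s * (1/2)" using e s(1) by simp
        also have "\<dots> \<le> e * s * (- B x)" using elim(3) e s(1) by (intro mult_left_mono) auto
        also have "\<dots> = (q - c) \<bullet> - \<nu> c"
          unfolding \<open>q - c = _\<close> inner_add_left using pn by (simp add: B_def)
        finally show "\<epsilon> * norm (q - c) < (q - c) \<bullet> - \<nu> c" .
      qed
      then have "\<Phi> x + (\<tau>0 x + e * s) *\<^sub>R n x \<in> C"
        using interior_subset by (auto simp: q_def p_def algebra_simps)
      with squeeze[of x "\<tau>0 x + e * s"] elim(3,4) e s(1) have "\<tau>0 x \<le> \<tau> x \<and> \<tau> x \<le> \<tau>0 x + e * s" by auto
      then show ?case by (simp add: tc t0c s_def)
    qed
  qed simp
  from has_derivative_add[OF this D0] show "\<exists>\<tau>'. (\<tau> has_derivative \<tau>') (at c within S)" by auto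
qed

text \<open>With \<open>S\<close> the shape operator, this is \<open>DF = I + d (I - d S)\<^sup>-\<^sup>T Hess d\<close> with the inverse cleared. Compared with the
  formula of the paper, the Hessian term has the opposite sign and half the size; for the unit disc,
  where \<open>S = - I\<close>, the normals spread away from a minimum of \<open>d\<close>.\<close>

lemma return_map_linearization:
  assumes \<Omega>: "\<Omega> \<in> class_O C" "C2_thickness C \<Omega>" and c: "c \<in> S" and pos: "thickness C \<Omega> c > 0"
    and crit: "bdry_grad C (thickness C \<Omega>) c = 0" and v: "v \<in> T c" and u: "u \<in> T c"
  shows "(bdry_deriv C (return_map C \<Omega>) c v - v) \<bullet> tubeD (thickness C \<Omega> c) c u =
    thickness C \<Omega> c * (bdry_hess C (thickness C \<Omega>) c v \<bullet> u)"
proof -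
  define d where "d = thickness C \<Omega>"
  have C2: "C2_on_bdry C d" using \<Omega>(2) by (auto simp: C2_thickness_def d_def)
  have dc: "d c > 0" and crit': "bdry_grad C d c = 0" using pos crit by (auto simp: d_def)
  define D where "D = bdry_deriv C (bdry_grad C d) c"
  obtain W where W: "(slope d has_derivative W) (at c within S)" "\<And>h u. W h \<bullet> tubeD (d c) c u = D h \<bullet> u"
    using slope_derivative[where f=d, OF C2 c dc crit'] unfolding D_def by blast
  have Dd: "(d has_derivative (\<lambda>h. 0)) (at c within S)"
    using bdry_grad_derivative(1)[OF C2 c] crit' by simp
  have "(d \<longlongrightarrow> d c) (at c within S)"
    using has_derivative_continuous[OF Dd] by (simp add: continuous_within)
  then have evpos: "\<forall>\<^sub>F x in at c within S. d x > 0" using order_tendstoD(1) dc by blast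
  have s0: "slope d c = 0" using slope(2)[of c d] c dc crit' by simp
  define m where "m x = \<nu> x - slope d x" for x
  define n where "n x = - sgn (m x)" for x
  \<comment> \<open>Derivative of the unnormalized outward normal \<open>m\<close>. Since
    \<open>m c\<close> is a unit vector, normalizing only adds the projection
    \<open>P c\<close>.\<close>
  define m' where "m' h = weingarten c h - W h" for h
  have mc: "m c = \<nu> c" by (simp add: m_def s0)
  have sm: "sgn (m c) = \<nu> c" using norm_normal[OF c] by (simp add: mc sgn_div_norm)
  have m0: "m x \<noteq> 0" if "x \<in> S" "d x > 0" for x
  proof
    assume "m x = 0"
    then have "slope d x = \<nu> x" by (simp add: m_def)
    then show False using slope_normal[where f=d, OF C2 that(1)] that normal_self by simp
  qed
  have Dm: "(m has_derivative m') (at c within S)"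
    unfolding m_def m'_def by (intro has_derivative_diff weingarten_derivative c W(1))
  have Dn: "(n has_derivative (\<lambda>h. - P c (m' h))) (at c within S)"
    using has_derivative_minus[OF has_derivative_sgn[OF Dm m0[OF c dc]]] norm_normal[OF c]
    unfolding n_def sm by (simp add: mc tangent_proj_def inner_commute)
  have nc: "n c = - \<nu> c" by (simp add: n_def sm)
  define \<Phi> where "\<Phi> = radial_map C \<Omega>"
  have D\<Phi>: "(\<Phi> has_derivative (\<lambda>h. h + (d c *\<^sub>R weingarten c h + 0 *\<^sub>R \<nu> c))) (at c within S)"
    unfolding \<Phi>_def radial_map_def[abs_def] d_def[symmetric]
    by (intro has_derivative_add has_derivative_ident has_derivative_scaleR Dd weingarten_derivative c)
  have \<Phi>c: "\<Phi> c = c + d c *\<^sub>R \<nu> c" by (simp add: \<Phi>_def radial_map_def d_def)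
  have n1: "\<forall>\<^sub>F x in at c within S. norm (n x) = 1"
    using evpos ev_S by eventually_elim (use m0 in \<open>simp add: n_def norm_sgn\<close>)
  define \<tau> where "\<tau> = (\<lambda>x. Inf {t. t \<ge> 0 \<and> \<Phi> x + t *\<^sub>R n x \<in> C})"
  have \<tau>c: "\<tau> c = d c" and "\<exists>\<tau>'. (\<tau> has_derivative \<tau>') (at c within S)"
    unfolding \<tau>_def using hitting_time_derivative[OF c D\<Phi> \<Phi>c dc Dn nc n1] by blast+
  then obtain \<tau>' where D\<tau>: "(\<tau> has_derivative \<tau>') (at c within S)" by blast
  define F' where "F' h = (h + (d c *\<^sub>R weingarten c h + 0 *\<^sub>R \<nu> c)) + (\<tau> c *\<^sub>R (- P c (m' h)) + \<tau>' h *\<^sub>R n c)" for h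
  have "((\<lambda>x. \<Phi> x + \<tau> x *\<^sub>R n x) has_derivative F') (at c within S)"
    unfolding F'_def by (intro has_derivative_add D\<Phi> has_derivative_scaleR D\<tau> Dn)
  then have "(return_map C \<Omega> has_derivative F') (at c within S)"
  proof (rule has_derivative_transform_eventually)
    have eq: "\<Phi> x + \<tau> x *\<^sub>R n x = return_map C \<Omega> x" if "d x > 0" "x \<in> S" for x
      using inward_normal_radial[OF \<Omega> that(2)] that(1)
      by (simp add: return_map_def reciprocal_map_def \<Phi>_def \<tau>_def n_def m_def d_def)
    show "\<forall>\<^sub>F x in at c within S. \<Phi> x + \<tau> x *\<^sub>R n x = return_map C \<Omega> x"
      using evpos ev_S by eventually_elim (rule eq)
    show "\<Phi> c + \<tau> c *\<^sub>R n c = return_map C \<Omega> c" using eq dc c by blast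
  qed (rule c)
  then have F: "bdry_deriv C (return_map C \<Omega>) c v = F' v" by (rule bdry_deriv_eq[OF c v])
  define z where "z = tubeD (d c) c u"
  have zT: "z \<in> T c" using u tubeD_normal[OF c] by (simp add: z_def tangent_space_def)
  \<comment> \<open>The unknown \<open>\<tau>'\<close> multiplies the normal \<open>n c\<close>,
    which is orthogonal to \<open>z\<close>. As the travel time \<open>\<tau> c\<close> equals
    \<open>d c\<close>, the curvature terms coming from \<open>\<Phi>\<close> and from the normal
    then cancel.\<close>
  have "(F' v - v) \<bullet> z = d c * (weingarten c v \<bullet> z) - d c * (m' v \<bullet> z)"
    using zT inner_tangent_proj[OF zT] unfolding F'_def \<tau>c nc
    by (simp add: inner_add_left inner_diff_left inner_commute[of "\<nu> c"] tangent_space_def)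
  also have "\<dots> = d c * (W v \<bullet> z)" by (simp add: m'_def inner_diff_left algebra_simps)
  also have "\<dots> = d c * (bdry_hess C d c v \<bullet> u)"
    unfolding z_def W(2) by (simp add: bdry_hess_def D_def inner_tangent_proj[OF u])
  finally show ?thesis using F by (simp add: z_def d_def)
qed

section \<open>The geometric operator as an inverse\<close>

lemma tubeD_surj_tangent:
  assumes c: "c \<in> S" and t: "t \<ge> 0" and v: "v \<in> T c"
  obtains z where "z \<in> T c" "tubeD t c z = v"
proof -
  obtain z where "tubeD t c z = v"
    using coercive_right_inverse[OF tubeD_linear[OF c] tubeD_coercive[OF c t]] by metis
  then show thesis using that tubeD_normal[OF c, of t z] v by (simp add: tangent_space_def)
qed

text \<open>\<open>shape_operator\<close> is minus \<open>weingarten\<close>, so I - d S is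
  \<open>tubeD\<close> on tangent vectors; surjectivity onto the tangent space makes
  \<open>inv_into\<close> a right inverse.\<close>

lemma tubeD_geometric_operator:
  assumes c: "c \<in> S" and pos: "thickness C \<Omega> c > 0" and v: "v \<in> T c"
  shows "tubeD (thickness C \<Omega> c) c (geometric_operator C \<Omega> c v) = (2 * thickness C \<Omega> c) *\<^sub>R v"
proof -
  define d where "d = thickness C \<Omega> c"
  define g where "g w = w - d *\<^sub>R shape_operator C c w" for w
  have g: "g w = tubeD d c w" if "w \<in> T c" for w
    using that by (simp add: g_def tubeD_def weingarten_shape)
  obtain z where z: "z \<in> T c" "tubeD d c z = v"
    using tubeD_surj_tangent[OF c _ v, of d] pos by (auto simp: d_def)
  then have "v \<in> g ` T c" using g by force
  then have "inv_into (T c) g v \<in> T c" "g (inv_into (T c) g v) = v"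
    by (rule inv_into_into, rule f_inv_into_f)
  then have "tubeD d c (inv_into (T c) g v) = v" using g by simp
  then show ?thesis unfolding geometric_operator_def d_def[symmetric] g_def[abs_def, symmetric]
    using tubeD_linear[OF c] by (simp add: linear_scale)
qed

end

text \<open>Unique determination is expressed by comparing two domains over one core. Positive
  thickness puts \<Phi>(c) outside \<open>C\<close>, where the reciprocal map is defined.\<close>

theorem proposition8p8:
  fixes C \<Omega> \<Omega>' :: "'a::euclidean_space set" and c :: 'a and K :: "'a \<Rightarrow> 'a"
  assumes "convex_core C"
    and "\<Omega> \<in> class_O C" and "C2_thickness C \<Omega>"
    and "nondegenerate_critical_point C (thickness C \<Omega>) c" and "thickness C \<Omega> c > 0"
    and "\<Omega>' \<in> class_O C" and "C2_thickness C \<Omega>'"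
    and "nondegenerate_critical_point C (thickness C \<Omega>') c" and "thickness C \<Omega>' c > 0"
    and "\<forall>v\<in>tangent_space C c. geometric_operator C \<Omega> c v = K v"
    and "\<forall>v\<in>tangent_space C c. geometric_operator C \<Omega>' c v = K v"
    and "\<forall>v\<in>tangent_space C c.
           bdry_deriv C (return_map C \<Omega>) c v = bdry_deriv C (return_map C \<Omega>') c v"
  shows "\<forall>v\<in>tangent_space C c.
           bdry_hess C (thickness C \<Omega>) c v = bdry_hess C (thickness C \<Omega>') c v"
proof
  interpret convex_core_set C by unfold_locales (rule assms(1))
  define d d' where "d = thickness C \<Omega> c" and "d' = thickness C \<Omega>' c"
  have d: "d > 0" "d' > 0" using assms(5,9) by (auto simp: d_def d'_def)
  have c: "c \<in> frontier C" and crit: "bdry_grad C (thickness C \<Omega>) c = 0" "bdry_grad C (thickness C \<Omega>') c = 0"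
    using assms(4,8) by (auto simp: nondegenerate_critical_point_def)
  have dd: "d = d'" if v: "v \<in> tangent_space C c" "v \<noteq> 0" for v
  proof -
    have K: "tubeD d c (K v) = (2 * d) *\<^sub>R v" "tubeD d' c (K v) = (2 * d') *\<^sub>R v"
      using tubeD_geometric_operator[OF c assms(5) v(1)] tubeD_geometric_operator[OF c assms(9) v(1)]
        assms(10,11) v(1) by (auto simp: d_def d'_def)
    from K have 1: "K v + d *\<^sub>R weingarten c (K v) = (2 * d) *\<^sub>R v"
      and 2: "K v + d' *\<^sub>R weingarten c (K v) = (2 * d') *\<^sub>R v" by (simp_all add: tubeD_def)
    have "K v \<noteq> 0"
    proof
      assume "K v = 0"
      then have "tubeD d c (K v) = 0" using linear_0[OF tubeD_linear[OF c]] by simp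
      then show False using K(1) d v(2) by simp
    qed
    \<comment> \<open>After scaling, both right-hand sides are 2 d d' v and the curvature terms
      agree, which leaves (d' - d) K v = 0.\<close>
    moreover have "d' *\<^sub>R K v + (d * d') *\<^sub>R weingarten c (K v) = d *\<^sub>R K v + (d * d') *\<^sub>R weingarten c (K v)"
      using arg_cong[OF 1, of "\<lambda>z. d' *\<^sub>R z"] arg_cong[OF 2, of "\<lambda>z. d *\<^sub>R z"]
      by (simp add: scaleR_add_right mult_ac)
    ultimately show ?thesis by simp
  qed
  fix v assume v: "v \<in> tangent_space C c"
  define h where "h = bdry_hess C (thickness C \<Omega>) c v - bdry_hess C (thickness C \<Omega>') c v"
  have hT: "h \<in> tangent_space C c"
    using tangent_proj_in[OF c] by (simp add: h_def bdry_hess_def tangent_space_def inner_diff_left)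
  have "h = 0"
  proof (rule ccontr)
    assume "h \<noteq> 0"
    \<comment> \<open>The nonzero \<open>h\<close> itself serves as the tangent vector on which the
      two operators are compared; in dimension one the tangent space is trivial and this case cannot
      occur.\<close>
    then have eq: "d = d'" using dd hT by blast
    have "d * (bdry_hess C (thickness C \<Omega>) c v \<bullet> h) = d * (bdry_hess C (thickness C \<Omega>') c v \<bullet> h)"
      using return_map_linearization[OF assms(2,3) c assms(5) crit(1) v hT]
        return_map_linearization[OF assms(6,7) c assms(9) crit(2) v hT] assms(12) v eq
      unfolding d_def d'_def by metis
    then have "h \<bullet> h = 0" using d(1) by (simp add: h_def inner_diff_left)
    then show False using \<open>h \<noteq> 0\<close> by simp
  qed
  then show "bdry_hess C (thickness C \<Omega>) c v = bdry_hess C (thickness C \<Omega>') c v" by (simp add: h_def)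
qed

end
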